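(* Let $p\in(1,\infty)$ and let $X=(X,d,\mu)$ be a $p$-admissible metric measure space. Let $\theta\ge 0$ and let $S\subset X$ be a closed nonempty set. If $S\in\mathcal{LCR}_\theta(X)$, then $\mathfrak M^{str}_\theta(S)\neq\emptyset$. Conversely, if $\mathfrak M_\theta(S)\neq\emptyset$, then $S\in\mathcal{LCR}_\theta(X)$.
   Context: A metric measure space is a triple $X=(X,d,\mu)$ with $(X,d)$ a complete separable metric space and $\mu$ a Borel regular measure with $0<\mu(B)<\infty$ for every ball $B$ and $\operatorname{supp}\mu=X$. All balls are closed: $B_r(x)=\{y\in X:d(x,y)\le r\}$; for a ball $B=B_r(x)$ and $\lambda>0$, $\lambda B=B_{\lambda r}(x)$ and $r(B)=r$. A measure on $X$ means a nonzero Borel regular locally finite (outer) measure on $X$. $\mu$ is uniformly locally doubling if for every $R>0$, $C_\mu(R):=\sup_{r\in(0,R]}\sup_{x\in X}\mu(B_{2r}(x))/\mu(B_r(x))<\infty$. For $f:X\to\mathbb R$, $\operatorname{lip}f(x)=\limsup_{y\to x}|f(y)-f(x)|/d(x,y)$ if $x$ is an accumulation point of $X$ and $\operatorname{lip}f(x)=0$ otherwise. For a measure $\mathfrak m$, a Borel set $G$ with $0<\mathfrak m(G)<\infty$ and $f\in L^1_{loc}(\mathfrak m)$, $\mathcal E_{\mathfrak m}(f,G)=\inf_{c\in\mathbb R}\frac{1}{\mathfrak m(G)}\int_G|f-c|\,d\mathfrak m$. $X$ supports a weak local $(1,q)$-Poincaré inequality if for every $R>0$ there are $C>0$, $\lambda\ge1$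 such that $\mathcal E_\mu(f,B_r(x))\le C r\big(\frac{1}{\mu(B_{\lambda r}(x))}\int_{B_{\lambda r}(x)}(\operatorname{lip}f)^q\,d\mu\big)^{1/q}$ for all Lipschitz $f:X\to\mathbb R$, all $x\in X$ and $r\in(0,R]$. $X$ is $q$-admissible ($X\in\mathfrak A_q$) if $\mu$ is uniformly locally doubling and $X$ supports a weak local $(1,q)$-Poincaré inequality. Codimensional Hausdorff contents: for $\theta\ge0$, $E\subset X$ and $\delta\in(0,\infty]$, $\mathcal H_{\theta,\delta}(E)=\inf\{\sum_i\mu(B_{r_i}(x_i))/r_i^{\theta}: E\subset\bigcup_iB_{r_i}(x_i),\ r_i<\delta\}$ (infimum over at most countable coverings by balls), and $\mathcal H_\theta(E)=\lim_{\delta\to0}\mathcal H_{\theta,\delta}(E)$. A set $S\subset X$ is lower codimension-$\theta$ content regular, written $S\in\mathcal{LCR}_\theta(X)$, if there is $\lambda>0$ such that $\mathcal H_{\theta,r}(B_r(x)\cap S)\ge\lambda\,\mu(B_r(x))/r^\theta$ for all $x\in S$ and $r\in(0,1]$. Regular sequences of measures: let $\theta\ge0$ and $S\subset X$ be closed and nonempty. A sequence $\{\mathfrak m_k\}_{k=0}^\infty$ of measures on $X$ is $\theta$-regular (with parameter $\epsilon\in(0,1)$), written $\{\mathfrak m_k\}\in\mathfrak M_\theta(S)$, if: (M1) $\operatorname{supp}\mathfrak m_k=S$ for all $k\in\mathbb N_0$; (M2) there is $C_1>0$ with $\mathfrak m_k(B_r(x))\le C_1\mu(B_r(x))/r^\theta$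 for all $k\in\mathbb N_0$, $x\in X$, $r\in(0,\epsilon^k]$; (M3) there is $C_2>0$ with $\mathfrak m_k(B_r(x))\ge C_2\mu(B_r(x))/r^\theta$ for all $k\in\mathbb N_0$, $x\in S$, $r\in[\epsilon^k,1]$; (M4) $\mathfrak m_k=w_k\mathfrak m_0$ with $w_k\in L^\infty(\mathfrak m_0)$, and there is $C_3>0$ with $\epsilon^{\theta j}/C_3\le w_k(x)/w_{k+j}(x)\le C_3$ for $\mathfrak m_0$-a.e. $x\in S$ and all $k,j\in\mathbb N_0$. It is strongly $\theta$-regular, written $\{\mathfrak m_k\}\in\mathfrak M^{str}_\theta(S)$, if in addition (M5) for every Borel set $E\subset S$, $\limsup_{k\to\infty}\mathfrak m_k(B_{\epsilon^k}(x)\cap E)/\mathfrak m_k(B_{\epsilon^k}(x))>0$ for $\mathfrak m_0$-a.e. $x\in E$. *)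

theory Defs
  imports "HOL-Analysis.Analysis"
begin

definition mms :: "'a::polish_space measure \<Rightarrow> bool" where
  "mms \<mu> \<longleftrightarrow> sets \<mu> = sets borel \<and>
     (\<forall>x r. 0 < r \<longrightarrow> 0 < emeasure \<mu> (cball x r) \<and> emeasure \<mu> (cball x r) < \<infinity>)"

definition is_measure_on :: "'a::polish_space measure \<Rightarrow> bool" where
  "is_measure_on m \<longleftrightarrow> sets m = sets borel \<and> emeasure m (space m) \<noteq> 0 \<and>
     (\<forall>x. \<exists>r>0. emeasure m (cball x r) < \<infinity>)"

definition support :: "'a::polish_space measure \<Rightarrow> 'a set" where
  "support m = {x. \<forall>r>0. 0 < emeasure m (cball x r)}"

definition unif_loc_doubling :: "'a::polish_space measure \<Rightarrow> bool" where
  "unif_loc_doubling \<mu> \<longleftrightarrow> (\<forall>R>0. \<exists>C. \<forall>r\<in>{0<..R}. \<forall>x.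
      measure \<mu> (cball x (2*r)) \<le> C * measure \<mu> (cball x r))"

definition lip :: "('a::polish_space \<Rightarrow> real) \<Rightarrow> 'a \<Rightarrow> ereal" where
  "lip f x = (if x islimpt (UNIV :: 'a set)
     then Limsup (at x) (\<lambda>y. ereal (\<bar>f y - f x\<bar> / dist x y)) else 0)"

definition osc :: "'a::polish_space measure \<Rightarrow> ('a \<Rightarrow> real) \<Rightarrow> 'a set \<Rightarrow> real" where
  "osc m f G = (INF c::real. (LINT x:G|m. \<bar>f x - c\<bar>) / measure m G)"

definition weak_local_poincare :: "'a::polish_space measure \<Rightarrow> real \<Rightarrow> bool" where
  "weak_local_poincare \<mu> q \<longleftrightarrow> (\<forall>R>0. \<exists>C>0. \<exists>lam\<ge>1. \<forall>f. (\<exists>L. L-lipschitz_on UNIV f) \<longrightarrow>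
     (\<forall>x. \<forall>r\<in>{0<..R}. osc \<mu> f (cball x r) \<le> C * r *
        ((1 / measure \<mu> (cball x (lam*r))) *
          enn2real (\<integral>\<^sup>+ y\<in>cball x (lam*r). ennreal (real_of_ereal (lip f y) powr q) \<partial>\<mu>)) powr (1/q)))"

definition admissible :: "'a::polish_space measure \<Rightarrow> real \<Rightarrow> bool" where
  "admissible \<mu> q \<longleftrightarrow> mms \<mu> \<and> unif_loc_doubling \<mu> \<and> weak_local_poincare \<mu> q"

definition Hcont :: "'a::polish_space measure \<Rightarrow> real \<Rightarrow> real \<Rightarrow> 'a set \<Rightarrow> ennreal" where
  "Hcont \<mu> \<theta> \<delta> E = (INF C \<in> {C :: ('a \<times> real) set. countable C \<and>
        (\<forall>(x,r)\<in>C. 0 < r \<and> r < \<delta>) \<and> E \<subseteq> (\<Union>(x,r)\<in>C. cball x r)}.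
      (\<Sum>\<^sub>\<infinity>(x,r)\<in>C. emeasure \<mu> (cball x r) / ennreal (r powr \<theta>)))"

definition LCR :: "'a::polish_space measure \<Rightarrow> real \<Rightarrow> 'a set \<Rightarrow> bool" where
  "LCR \<mu> \<theta> S \<longleftrightarrow> (\<exists>lam>0. \<forall>x\<in>S. \<forall>r\<in>{0<..1}.
      Hcont \<mu> \<theta> r (cball x r \<inter> S) \<ge> ennreal lam * emeasure \<mu> (cball x r) / ennreal (r powr \<theta>))"

definition regular_seq_eps ::
  "'a::polish_space measure \<Rightarrow> real \<Rightarrow> 'a set \<Rightarrow> real \<Rightarrow> (nat \<Rightarrow> 'a measure) \<Rightarrow> bool" where
  "regular_seq_eps \<mu> \<theta> S \<epsilon> m \<longleftrightarrow> 0 < \<epsilon> \<and> \<epsilon> < 1 \<and> (\<forall>k. is_measure_on (m k)) \<and>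
     (\<forall>k. support (m k) = S) \<and>
     (\<exists>C1>0. \<forall>k x r. 0 < r \<and> r \<le> \<epsilon>^k \<longrightarrow>
        emeasure (m k) (cball x r) \<le> ennreal C1 * emeasure \<mu> (cball x r) / ennreal (r powr \<theta>)) \<and>
     (\<exists>C2>0. \<forall>k. \<forall>x\<in>S. \<forall>r. \<epsilon>^k \<le> r \<and> r \<le> 1 \<longrightarrow>
        emeasure (m k) (cball x r) \<ge> ennreal C2 * emeasure \<mu> (cball x r) / ennreal (r powr \<theta>)) \<and>
     (\<exists>w :: nat \<Rightarrow> 'a \<Rightarrow> real.
        (\<forall>k. w k \<in> borel_measurable (m 0) \<and> (\<exists>B. AE x in m 0. \<bar>w k x\<bar> \<le> B) \<and>
             (AE x in m 0. 0 \<le> w k x) \<and> m k = density (m 0) (\<lambda>x. ennreal (w k x))) \<and>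
        (\<exists>C3>0. \<forall>k j. AE x in m 0. x \<in> S \<longrightarrow>
             \<epsilon> powr (\<theta> * real j) / C3 \<le> w k x / w (k + j) x \<and> w k x / w (k + j) x \<le> C3))"

definition regular_seq :: "'a::polish_space measure \<Rightarrow> real \<Rightarrow> 'a set \<Rightarrow> (nat \<Rightarrow> 'a measure) \<Rightarrow> bool" where
  "regular_seq \<mu> \<theta> S m \<longleftrightarrow> (\<exists>\<epsilon>. regular_seq_eps \<mu> \<theta> S \<epsilon> m)"

definition strongly_regular_seq ::
  "'a::polish_space measure \<Rightarrow> real \<Rightarrow> 'a set \<Rightarrow> (nat \<Rightarrow> 'a measure) \<Rightarrow> bool" where
  "strongly_regular_seq \<mu> \<theta> S m \<longleftrightarrow> (\<exists>\<epsilon>. regular_seq_eps \<mu> \<theta> S \<epsilon> m \<and>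
     (\<forall>E \<in> sets borel. E \<subseteq> S \<longrightarrow> (AE x in m 0. x \<in> E \<longrightarrow>
        0 < limsup (\<lambda>k. ereal (measure (m k) (cball x (\<epsilon>^k) \<inter> E) / measure (m k) (cball x (\<epsilon>^k)))))))"

end

theory Submission
  imports Defs "HOL-Probability.Probability"
begin

text \<open>Only the doubling property of \<open>\<mu>\<close> is needed. For the converse, the content of \<open>cball x r \<inter> S\<close>
  is bounded below by mass distribution with \<open>m k\<close>, where \<open>\<epsilon> ^ Suc k \<le> r \<le> \<epsilon> ^ k\<close>.

  For the existence, take maximal \<open>e ^ k\<close>-separated subsets \<open>V k\<close> of \<open>S\<close>, make them the levels of a tree by a
  parent rule in the style of Christ's dyadic cubes, and attach to the vertices nested, level-wise
  disjoint cells \<open>Q k z\<close> of \<open>X\<close>. With \<open>h k z = \<mu> (Q k z) / e ^ (k \<theta>)\<close>, the content \<open>a\<close> of a vertex relative to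
  coverings by its descendants satisfies \<open>a k z = min (h k z) (\<Sum> a (Suc k) w)\<close>, the sum being over the children,
  and lower content regularity gives \<open>a \<ge> c0 h\<close>. As in Frostman's lemma, each level \<open>k\<close> yields a measure on
  the infinite paths with mass \<open>a k z\<close> on the paths through \<open>z \<in> V k\<close>, which splits below \<open>z\<close> in proportion
  to \<open>a\<close>. All these measures have densities with respect to one probability, and the ratio of the densities
  at levels \<open>k\<close> and \<open>k + 1\<close> is \<open>a k z\<close> over the sum of \<open>a\<close> over the children. It lies in \<open>[e powr \<theta>, 1]\<close>:
  the lower bound uses that the cells of the children are disjoint subsets of the cell of the parent, and
  it is free of constants, so that the product over \<open>j\<close> levels is at least \<open>e powr (\<theta> j)\<close>. The measures
  wanted on \<open>S\<close> are the images under the limit map on paths.\<close>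

section \<open>Doubling measures, contents and separated sets\<close>

lemma mms_emeasure_cball:
  assumes "mms \<mu>" "0 < r"
  shows "emeasure \<mu> (cball x r) = ennreal (measure \<mu> (cball x r))" "0 < measure \<mu> (cball x r)"
proof -
  have "0 < emeasure \<mu> (cball x r)" "emeasure \<mu> (cball x r) < \<infinity>"
    using assms by (auto simp: mms_def)
  then show "emeasure \<mu> (cball x r) = ennreal (measure \<mu> (cball x r))"
    by (intro emeasure_eq_ennreal_measure) auto
  with \<open>0 < emeasure \<mu> (cball x r)\<close> show "0 < measure \<mu> (cball x r)"
    by (metis ennreal_less_zero_iff)
qed

lemma mms_sets: "mms \<mu> \<Longrightarrow> sets \<mu> = sets borel"
  by (simp add: mms_def)

lemma mms_measure_mono:
  assumes "mms \<mu>" "A \<in> sets borel" "B \<in> sets borel" "A \<subseteq> B" "B \<subseteq> cball x r" "0 < r"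
  shows "measure \<mu> A \<le> measure \<mu> B"
proof (rule measure_mono_fmeasurable)
  have "emeasure \<mu> B \<le> emeasure \<mu> (cball x r)"
    using assms by (intro emeasure_mono) (auto simp: mms_sets)
  also have "\<dots> < \<infinity>"
    using assms by (auto simp: mms_def)
  finally show "B \<in> fmeasurable \<mu>"
    using assms by (auto simp: fmeasurable_def mms_sets)
qed (use assms in \<open>auto simp: mms_sets\<close>)

lemma doubling_uniform:
  fixes \<mu> :: "'a::polish_space measure"
  assumes "mms \<mu>" "unif_loc_doubling \<mu>" "0 < R"
  shows "\<exists>D\<ge>1. \<forall>x. \<forall>r\<in>{0<..R}. measure \<mu> (cball x (A * r)) \<le> D * measure \<mu> (cball x r)"
proof -
  obtain n where n: "A < 2 ^ n"
    using real_arch_pow[of 2 A] by auto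
  \<comment> \<open>The range of radii is enlarged to \<open>2 ^ n * R\<close> because the
    intermediate balls of the iteration may have radii beyond \<open>R\<close>.\<close>
  obtain C where C: "\<And>r x. r \<in> {0<..2 ^ n * R} \<Longrightarrow> measure \<mu> (cball x (2 * r)) \<le> C * measure \<mu> (cball x r)"
    using assms(2,3) unfolding unif_loc_doubling_def by (metis mult_pos_pos zero_less_numeral zero_less_power)
  define C' where "C' = max 1 C"
  have C': "measure \<mu> (cball x (2 * r)) \<le> C' * measure \<mu> (cball x r)" if "r \<in> {0<..2 ^ n * R}" for r x
  proof -
    have "measure \<mu> (cball x (2 * r)) \<le> C * measure \<mu> (cball x r)"
      using C[OF that] .
    also have "\<dots> \<le> C' * measure \<mu> (cball x r)"
      unfolding C'_def by (intro mult_right_mono) auto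
    finally show ?thesis .
  qed
  have iter: "measure \<mu> (cball x (2 ^ i * r)) \<le> C' ^ i * measure \<mu> (cball x r)" if "i \<le> n" "0 < r" "r \<le> R" for i x r
    using that(1)
  proof (induction i)
    case (Suc i)
    have "(2::real) ^ i * r \<le> 2 ^ n * R"
      using Suc that by (intro mult_mono power_increasing) auto
    then have "measure \<mu> (cball x (2 * (2 ^ i * r))) \<le> C' * measure \<mu> (cball x (2 ^ i * r))"
      using that by (intro C') auto
    also have "\<dots> \<le> C' * (C' ^ i * measure \<mu> (cball x r))"
      using Suc by (intro mult_left_mono) (auto simp: C'_def)
    finally show ?case by (simp add: mult_ac)
  qed simp
  have "measure \<mu> (cball x (A * r)) \<le> C' ^ n * measure \<mu> (cball x r)" if "r \<in> {0<..R}" for x r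
  proof -
    have "A * r \<le> 2 ^ n * r"
      using n that by (intro mult_right_mono) auto
    then have "measure \<mu> (cball x (A * r)) \<le> measure \<mu> (cball x (2 ^ n * r))"
      using that by (intro mms_measure_mono[OF assms(1), of _ _ x "2 ^ n * r"] subset_cball) auto
    also have "\<dots> \<le> C' ^ n * measure \<mu> (cball x r)"
      using that by (intro iter) auto
    finally show ?thesis .
  qed
  moreover have "1 \<le> C' ^ n"
    by (auto simp: C'_def intro!: one_le_power)
  ultimately show ?thesis by blast
qed

lemma Hcont_mono: "E \<subseteq> F \<Longrightarrow> Hcont \<mu> \<theta> \<delta> E \<le> Hcont \<mu> \<theta> \<delta> F"
  unfolding Hcont_def by (rule INF_superset_mono) auto

lemma Hcont_single:
  assumes "0 < r" "r < \<delta>" "E \<subseteq> cball x r"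
  shows "Hcont \<mu> \<theta> \<delta> E \<le> emeasure \<mu> (cball x r) / ennreal (r powr \<theta>)"
  unfolding Hcont_def by (rule INF_lower2[of "{(x, r)}"]) (use assms in auto)

lemma infsum_ennreal_mono_set:
  fixes f :: "'a \<Rightarrow> ennreal"
  assumes "A \<subseteq> B"
  shows "infsum f A \<le> infsum f B"
  by (rule infsum_mono_neutral) (use assms in \<open>auto intro: nonneg_summable_on_complete\<close>)

lemma Hcont_Un: "Hcont \<mu> \<theta> \<delta> (E \<union> F) \<le> Hcont \<mu> \<theta> \<delta> E + Hcont \<mu> \<theta> \<delta> F"
proof (rule ennreal_le_epsilon)
  let ?s = "\<lambda>C. \<Sum>\<^sub>\<infinity>(x,r)\<in>C. emeasure \<mu> (cball x r) / ennreal (r powr \<theta>)"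
  let ?ok = "\<lambda>E C. countable C \<and> (\<forall>(x,r)\<in>C. 0 < r \<and> r < \<delta>) \<and> E \<subseteq> (\<Union>(x,r)\<in>C. cball x r)"
  have ex: "\<exists>C. ?ok E C \<and> ?s C < Hcont \<mu> \<theta> \<delta> E + ennreal (e/2)"
    if "Hcont \<mu> \<theta> \<delta> E < top" "0 < e" for E e
  proof -
    have "Hcont \<mu> \<theta> \<delta> E < Hcont \<mu> \<theta> \<delta> E + ennreal (e/2)"
      using that by (cases "Hcont \<mu> \<theta> \<delta> E") (auto simp flip: ennreal_plus simp: ennreal_less_iff)
    then show ?thesis
      unfolding Hcont_def[of _ _ _ E] by (subst (asm) INF_less_iff) auto
  qed
  fix e :: real assume fin: "Hcont \<mu> \<theta> \<delta> E + Hcont \<mu> \<theta> \<delta> F < top" and e: "0 < e"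
  obtain C where C: "?ok E C" "?s C < Hcont \<mu> \<theta> \<delta> E + ennreal (e/2)"
    using ex[of E e] fin e by auto
  obtain C' where C': "?ok F C'" "?s C' < Hcont \<mu> \<theta> \<delta> F + ennreal (e/2)"
    using ex[of F e] fin e by auto
  have "Hcont \<mu> \<theta> \<delta> (E \<union> F) \<le> ?s (C \<union> C')"
    unfolding Hcont_def by (rule INF_lower) (use C(1) C'(1) in auto)
  \<comment> \<open>Coverings are sets of pairs, so a ball in both \<open>C\<close> and
    \<open>C'\<close> counts only once in the union. Splitting off \<open>C' - C\<close> makes the
    union disjoint.\<close>
  also have "?s (C \<union> C') = ?s (C \<union> (C' - C))"
    by (rule arg_cong[where f="?s"]) auto
  also have "\<dots> = ?s C + ?s (C' - C)"
    by (rule infsum_Un_disjoint) (auto intro: nonneg_summable_on_complete)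
  also have "\<dots> \<le> ?s C + ?s C'"
    by (intro add_left_mono infsum_ennreal_mono_set) auto
  also have "\<dots> \<le> (Hcont \<mu> \<theta> \<delta> E + ennreal (e/2)) + (Hcont \<mu> \<theta> \<delta> F + ennreal (e/2))"
    by (intro add_mono less_imp_le C C')
  also have "\<dots> = Hcont \<mu> \<theta> \<delta> E + Hcont \<mu> \<theta> \<delta> F + ennreal e"
    using e by (simp add: add_ac flip: ennreal_plus)
  finally show "Hcont \<mu> \<theta> \<delta> (E \<union> F) \<le> Hcont \<mu> \<theta> \<delta> E + Hcont \<mu> \<theta> \<delta> F + ennreal e" .
qed

lemma Hcont_empty: "Hcont \<mu> \<theta> \<delta> {} = 0"
proof -
  have "Hcont \<mu> \<theta> \<delta> {} \<le> 0"
    unfolding Hcont_def by (rule INF_lower2[of "{}"]) auto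
  then show ?thesis by simp
qed

lemma Hcont_UN:
  "finite I \<Longrightarrow> Hcont \<mu> \<theta> \<delta> (\<Union>i\<in>I. E i) \<le> (\<Sum>i\<in>I. Hcont \<mu> \<theta> \<delta> (E i))"
proof (induction I rule: finite_induct)
  case (insert i I)
  have "Hcont \<mu> \<theta> \<delta> (\<Union>j\<in>insert i I. E j) \<le> Hcont \<mu> \<theta> \<delta> (E i) + Hcont \<mu> \<theta> \<delta> (\<Union>j\<in>I. E j)"
    using Hcont_Un[of \<mu> \<theta> \<delta> "E i" "\<Union>j\<in>I. E j"] by simp
  also have "\<dots> \<le> Hcont \<mu> \<theta> \<delta> (E i) + (\<Sum>i\<in>I. Hcont \<mu> \<theta> \<delta> (E i))"
    by (intro add_left_mono insert.IH)
  finally show ?case using insert by simp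
qed (simp add: Hcont_empty)

lemma maximal_separated_net:
  fixes S :: "'a::{metric_space, second_countable_topology} set"
  assumes "0 < t"
  obtains V where "V \<subseteq> S" "countable V" "\<And>x y. x \<in> V \<Longrightarrow> y \<in> V \<Longrightarrow> x \<noteq> y \<Longrightarrow> t < dist x y"
    "\<And>x. x \<in> S \<Longrightarrow> \<exists>y\<in>V. dist x y \<le> t"
proof -
  define F where "F = {V. V \<subseteq> S \<and> (\<forall>x\<in>V. \<forall>y\<in>V. x \<noteq> y \<longrightarrow> t < dist x y)}"
  have "\<exists>V\<in>F. \<forall>X\<in>F. V \<subseteq> X \<longrightarrow> X = V"
  proof (rule subset_Zorn')
    fix C assume C: "subset.chain F C"
    show "\<Union>C \<in> F"
      unfolding F_def
    proof (safe)
      fix x X assume "x \<in> X" "X \<in> C" then show "x \<in> S"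
        using C by (auto simp: subset.chain_def F_def)
    next
      fix x y X Y assume *: "x \<in> X" "X \<in> C" "y \<in> Y" "Y \<in> C" "x \<noteq> y"
      then have "X \<subseteq> Y \<or> Y \<subseteq> X" "X \<in> F" "Y \<in> F"
        using C by (auto simp: subset_chain_def)
      then show "t < dist x y"
        using * by (auto simp: F_def)
    qed
  qed
  then obtain V where V: "V \<in> F" "\<And>X. X \<in> F \<Longrightarrow> V \<subseteq> X \<Longrightarrow> X = V"
    by blast
  have sep: "t < dist x y" if "x \<in> V" "y \<in> V" "x \<noteq> y" for x y
    using V(1) that by (auto simp: F_def)
  have net: "\<exists>y\<in>V. dist x y \<le> t" if "x \<in> S" for x
  proof (rule ccontr)
    assume *: "\<not> (\<exists>y\<in>V. dist x y \<le> t)"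
    then have "insert x V \<in> F"
      using V(1) that by (auto simp: F_def not_le dist_commute)
    from V(2)[OF this] have "x \<in> V" by auto
    with * assms show False by force
  qed
  \<comment> \<open>Balls of half the separation are pairwise disjoint and open, and a second
    countable space has only countably many such sets.\<close>
  have "countable ((\<lambda>x. ball x (t/2)) ` V)"
  proof (rule countable_disjoint_open_subsets)
    show "disjoint ((\<lambda>x. ball x (t/2)) ` V)"
    proof (rule disjointI)
      fix A B assume "A \<in> (\<lambda>x. ball x (t/2)) ` V" "B \<in> (\<lambda>x. ball x (t/2)) ` V" "A \<noteq> B"
      then obtain x y where xy: "x \<in> V" "y \<in> V" "A = ball x (t/2)" "B = ball y (t/2)" "x \<noteq> y"
        by auto
      have "dist x y < t/2 + t/2" if "z \<in> A" "z \<in> B" for z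
        using that dist_triangle[of x y z] unfolding xy by (simp add: dist_commute)
      with sep[of x y] xy show "A \<inter> B = {}"
        by force
    qed
  qed auto
  moreover have "inj_on (\<lambda>x. ball x (t/2)) V"
  proof (rule inj_onI, rule ccontr)
    fix x y assume *: "x \<in> V" "y \<in> V" "ball x (t/2) = ball y (t/2)" "x \<noteq> y"
    then have "x \<in> ball y (t/2)" using assms by force
    with sep[of x y] * assms show False by (auto simp: dist_commute)
  qed
  ultimately have "countable V"
    by (rule countable_image_inj_on)
  with V(1) sep net show ?thesis
    by (intro that) (auto simp: F_def)
qed

text \<open>Splitting a set along \<open>{x. g x < f x}\<close> and using the hypothesis on that
  part shows that \<open>max f g\<close> and \<open>g\<close> define the same measure; uniqueness of
  densities then makes them agree almost everywhere. Nothing is subtracted, so infinite values do no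
  harm.\<close>

lemma (in sigma_finite_measure) AE_le_of_density_le:
  fixes f g :: "'a \<Rightarrow> ennreal"
  assumes [measurable]: "f \<in> borel_measurable M" "g \<in> borel_measurable M"
    and le: "\<And>A. A \<in> sets M \<Longrightarrow> emeasure (density M f) A \<le> emeasure (density M g) A"
  shows "AE x in M. f x \<le> g x"
proof -
  have "density M (\<lambda>x. max (f x) (g x)) = density M g"
  proof (rule measure_eqI)
    fix A assume "A \<in> sets (density M (\<lambda>x. max (f x) (g x)))"
    then have A[measurable]: "A \<in> sets M" by simp
    define B where "B = A \<inter> {x \<in> space M. g x < f x}"
    have B[measurable]: "B \<in> sets M" unfolding B_def by measurable
    have sp: "x \<in> A \<Longrightarrow> x \<in> space M" for x
      using sets.sets_into_space[OF A] by auto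
    have eq: "emeasure (density M (\<lambda>x. max (f x) (g x))) A = emeasure (density M f) B + emeasure (density M g) (A - B)"
      by (auto simp: emeasure_density B_def sp max_def split: split_indicator
          intro!: nn_integral_cong simp flip: nn_integral_add)
    also have "\<dots> \<le> emeasure (density M g) B + emeasure (density M g) (A - B)"
      by (intro add_right_mono le) measurable
    also have "\<dots> = emeasure (density M g) A"
      by (subst plus_emeasure) (auto simp: B_def intro!: arg_cong[where f="emeasure _"])
    finally have "emeasure (density M (\<lambda>x. max (f x) (g x))) A \<le> emeasure (density M g) A" .
    moreover have "emeasure (density M g) A \<le> emeasure (density M (\<lambda>x. max (f x) (g x))) A"
      by (auto simp: emeasure_density intro!: nn_integral_mono mult_right_mono)
    ultimately show "emeasure (density M (\<lambda>x. max (f x) (g x))) A = emeasure (density M g) A"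
      by simp
  qed simp
  then have "AE x in M. max (f x) (g x) = g x"
    by (intro density_unique) auto
  then show ?thesis
    by eventually_elim (metis max.cobounded1)
qed

section \<open>Random paths in a tree\<close>

text \<open>The map \<open>\<pi> n\<close> goes from level \<open>Suc n\<close> to its parents on
  level \<open>n\<close>, and \<open>anc \<pi> n j z\<close> is the ancestor on level
  \<open>j\<close>. The same point may occur on several levels, so the level \<open>n\<close> of
  \<open>z\<close> has to be passed along.\<close>

fun anc :: "(nat \<Rightarrow> 'a \<Rightarrow> 'a) \<Rightarrow> nat \<Rightarrow> nat \<Rightarrow> 'a \<Rightarrow> 'a" where
  "anc \<pi> 0 j z = z"
| "anc \<pi> (Suc n) j z = (if j \<le> n then anc \<pi> n j (\<pi> n z) else z)"

lemma anc_self[simp]: "n \<le> j \<Longrightarrow> anc \<pi> n j z = z"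
  by (cases n) auto

lemma anc_anc: "j \<le> m \<Longrightarrow> m \<le> n \<Longrightarrow> anc \<pi> m j (anc \<pi> n m z) = anc \<pi> n j z"
  by (induction n arbitrary: z) (auto simp: le_Suc_eq)

lemma anc_parent: "j < n \<Longrightarrow> anc \<pi> n j z = \<pi> j (anc \<pi> n (Suc j) z)"
  using anc_anc[of j "Suc j" n \<pi> z] by simp

lemma map_pmf_anc:
  assumes "\<And>n. map_pmf (\<pi> n) (p (Suc n)) = p n" "m \<le> n"
  shows "map_pmf (anc \<pi> n m) (p n) = p m"
  using assms(2)
proof (induction n)
  case (Suc n)
  show ?case
  proof (cases "m \<le> n")
    case True
    then have "map_pmf (anc \<pi> (Suc n) m) (p (Suc n)) = map_pmf (anc \<pi> n m) (map_pmf (\<pi> n) (p (Suc n)))"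
      by (auto simp: pmf.map_comp o_def intro!: map_pmf_cong)
    also have "\<dots> = p m"
      using True Suc assms(1) by simp
    finally show ?thesis .
  next
    case False
    with Suc have "m = Suc n" by simp
    then show ?thesis by (simp add: map_pmf_cong[OF refl anc_self])
  qed
qed (simp add: map_pmf_cong[OF refl anc_self])

text \<open>The space of infinite paths of a tree, with given laws of the vertices on each level.
  It is a projective limit, since the law of finitely many vertices of the path is a
  function of the deepest one.\<close>

lemma pmf_chain_measure:
  fixes p :: "nat \<Rightarrow> 'a::polish_space pmf"
  assumes p: "\<And>n. map_pmf (\<pi> n) (p (Suc n)) = p n"
  obtains P :: "(nat \<Rightarrow> 'a) measure" where "prob_space P" "sets P = sets (PiM UNIV (\<lambda>_. borel))"
    "\<And>n A. A \<in> sets borel \<Longrightarrow> emeasure P {\<omega>. \<omega> n \<in> A} = emeasure (measure_pmf (p n)) A"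
    "AE \<omega> in P. \<forall>n. \<pi> n (\<omega> (Suc n)) = \<omega> n"
proof -
  \<comment> \<open>The depth of a finite set of levels, with value 0 for the empty set. The law
    \<open>Q J\<close> reads all levels in \<open>J\<close> off a single vertex of that
    depth.\<close>
  define N where "N J = Max (insert 0 J)" for J :: "nat set"
  define Q where "Q J = distr (measure_pmf (p (N J))) (PiM J (\<lambda>_. borel)) (\<lambda>z. \<lambda>j\<in>J. anc \<pi> (N J) j z)" for J
  have meas: "(\<lambda>z. \<lambda>j\<in>J. anc \<pi> n j z) \<in> measurable (measure_pmf q) (PiM J (\<lambda>_. borel))" for J n q
    by (auto simp: space_PiM)
  have N: "j \<le> N J" if "j \<in> J" "finite J" for j J
    using that unfolding N_def by (intro Max_ge) auto
  \<comment> \<open>Consistency of the level laws lets the vertex be taken at any greater depth. Two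
    nested index sets can then be read off the same vertex, which is what projectivity asks
    for.\<close>
  have eq: "Q J = distr (measure_pmf (p n)) (PiM J (\<lambda>_. borel)) (\<lambda>z. \<lambda>j\<in>J. anc \<pi> n j z)"
    if "N J \<le> n" "finite J" for J n
  proof -
    have "Q J = distr (distr (measure_pmf (p n)) (measure_pmf (p (N J))) (anc \<pi> n (N J)))
        (PiM J (\<lambda>_. borel)) (\<lambda>z. \<lambda>j\<in>J. anc \<pi> (N J) j z)"
      unfolding Q_def map_pmf_anc[of \<pi> p, OF p that(1), symmetric] map_pmf_rep_eq
      by (intro distr_cong) auto
    also have "\<dots> = distr (measure_pmf (p n)) (PiM J (\<lambda>_. borel)) (\<lambda>z. \<lambda>j\<in>J. anc \<pi> (N J) j (anc \<pi> n (N J) z))"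
      by (subst distr_distr) (auto simp: o_def space_PiM)
    also have "\<dots> = distr (measure_pmf (p n)) (PiM J (\<lambda>_. borel)) (\<lambda>z. \<lambda>j\<in>J. anc \<pi> n j z)"
      using N that by (intro distr_cong) (auto simp: restrict_def anc_anc)
    finally show ?thesis .
  qed
  have NJ: "N J \<le> N H" if "J \<subseteq> H" "finite H" for J H
    unfolding N_def using that finite_subset by (intro Max_mono) auto
  interpret polish_projective UNIV Q
  proof (intro polish_projective.intro projective_family.intro)
    fix J H :: "nat set" assume *: "J \<subseteq> H" "finite H"
    then have "finite J" using finite_subset by auto
    with * have "Q J = distr (measure_pmf (p (N H))) (PiM J (\<lambda>_. borel)) (\<lambda>z. \<lambda>j\<in>J. anc \<pi> (N H) j z)"
      by (intro eq NJ)
    also have "\<dots> = distr (Q H) (PiM J (\<lambda>_. borel)) (\<lambda>f. restrict f J)"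
      unfolding Q_def distr_distr[OF measurable_restrict_subset[OF *(1)] meas]
      using * by (intro distr_cong) (auto simp: restrict_def fun_eq_iff)
    finally show "Q J = distr (Q H) (PiM J (\<lambda>_. borel)) (\<lambda>f. restrict f J)" .
  next
    fix J :: "nat set"
    show "prob_space (Q J)"
      unfolding Q_def by (rule prob_space.prob_space_distr[OF prob_space_measure_pmf meas])
  qed
  have sp: "space lim = UNIV"
    by (simp add: space_PiM)
  have cyl: "emeasure lim {\<omega>. restrict \<omega> J \<in> X} = emeasure (measure_pmf (p n)) {z. (\<lambda>j\<in>J. anc \<pi> n j z) \<in> X}"
    if "finite J" "\<And>j. j \<in> J \<Longrightarrow> j \<le> n" "X \<in> sets (PiM J (\<lambda>_. borel))" for J n X
  proof -
    have "N J \<le> n"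
      using that unfolding N_def by auto
    have "emeasure lim {\<omega>. restrict \<omega> J \<in> X} = emeasure lim (prod_emb UNIV (\<lambda>_. borel) J X)"
      by (rule arg_cong[where f="emeasure lim"]) (auto simp: prod_emb_def)
    also have "\<dots> = emeasure (Q J) X"
      using that by (intro emeasure_lim_emb) auto
    also have "\<dots> = emeasure (measure_pmf (p n)) {z. (\<lambda>j\<in>J. anc \<pi> n j z) \<in> X}"
      unfolding eq[OF \<open>N J \<le> n\<close> that(1)] by (subst emeasure_distr) (auto simp: that(3) space_PiM intro!: arg_cong2[where f=emeasure])
    finally show ?thesis .
  qed
  have law: "emeasure lim {\<omega>. \<omega> n \<in> A} = emeasure (measure_pmf (p n)) A" if [measurable]: "A \<in> sets borel" for n A
  proof -
    have "emeasure lim {\<omega>. \<omega> n \<in> A} = emeasure lim {\<omega>. restrict \<omega> {n} \<in> {f \<in> space (PiM {n} (\<lambda>_. borel)). f n \<in> A}}"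
      by (rule arg_cong[where f="emeasure lim"]) (auto simp: space_PiM)
    also have "\<dots> = emeasure (measure_pmf (p n)) {z. (\<lambda>j\<in>{n}. anc \<pi> n j z) \<in> {f \<in> space (PiM {n} (\<lambda>_. borel)). f n \<in> A}}"
      by (intro cyl) auto
    also have "\<dots> = emeasure (measure_pmf (p n)) A"
      by (rule arg_cong[where f="emeasure (measure_pmf (p n))"]) (auto simp: space_PiM)
    finally show ?thesis .
  qed
  have path: "AE \<omega> in lim. \<pi> n (\<omega> (Suc n)) = \<omega> n" for n
  proof -
    have coord: "(\<lambda>\<omega>. \<omega> i) \<in> measurable lim borel" for i
      by (subst measurable_cong_sets[OF sets_lim refl]) (rule measurable_component_singleton, simp)
    \<comment> \<open>The map \<open>\<pi> n\<close> need not be measurable, so the event is split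
      over the countably many values \<open>z\<close> of the deeper vertex; for each of them
      \<open>\<pi> n z\<close> is a constant.\<close>
    have "AE \<omega> in lim. \<omega> (Suc n) \<in> set_pmf (p (Suc n))"
    proof (rule P.AE_I_eq_1)
      have "countable (set_pmf (p (Suc n)))" by simp
      then have [measurable]: "set_pmf (p (Suc n)) \<in> sets borel"
        by (auto intro: borel_closed sets.countable)
      show "{\<omega> \<in> space lim. \<omega> (Suc n) \<in> set_pmf (p (Suc n))} \<in> P.events"
        using coord[of "Suc n"] by measurable
      show "emeasure lim {\<omega> \<in> space lim. \<omega> (Suc n) \<in> set_pmf (p (Suc n))} = 1"
        using law[of "set_pmf (p (Suc n))" "Suc n"] sp by (simp add: emeasure_pmf del: space_lim)
    qed
    moreover have "AE \<omega> in lim. \<forall>z\<in>set_pmf (p (Suc n)). \<not> (\<omega> (Suc n) = z \<and> \<omega> n \<noteq> \<pi> n z)"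
    proof (subst AE_ball_countable)
      show "\<forall>z\<in>set_pmf (p (Suc n)). AE \<omega> in lim. \<not> (\<omega> (Suc n) = z \<and> \<omega> n \<noteq> \<pi> n z)"
      proof
        fix z
        let ?J = "{n, Suc n}"
        let ?X = "{f \<in> space (PiM ?J (\<lambda>_. borel)). f (Suc n) = z \<and> f n \<noteq> \<pi> n z}"
        have X: "?X \<in> sets (PiM ?J (\<lambda>_. borel))"
          by measurable
        have "emeasure lim {\<omega>. restrict \<omega> ?J \<in> ?X} = emeasure (measure_pmf (p (Suc n))) {z. (\<lambda>j\<in>?J. anc \<pi> (Suc n) j z) \<in> ?X}"
          by (intro cyl X) auto
        also have "{z. (\<lambda>j\<in>?J. anc \<pi> (Suc n) j z) \<in> ?X} = {}"
          by (auto simp: space_PiM)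
        finally have "emeasure lim {\<omega>. restrict \<omega> ?J \<in> ?X} = 0"
          by (simp only: emeasure_empty)
        moreover have "{\<omega>. restrict \<omega> ?J \<in> ?X} = {\<omega> \<in> space lim. \<omega> (Suc n) = z \<and> \<omega> n \<noteq> \<pi> n z}"
          by (auto simp: space_PiM)
        moreover have "{\<omega> \<in> space lim. \<omega> (Suc n) = z \<and> \<omega> n \<noteq> \<pi> n z} \<in> sets lim"
          using coord[of n] coord[of "Suc n"] by measurable
        ultimately show "AE \<omega> in lim. \<not> (\<omega> (Suc n) = z \<and> \<omega> n \<noteq> \<pi> n z)"
          by (subst AE_iff_measurable[OF _ refl]) (simp_all only: not_not)
      qed
    qed auto
    ultimately show ?thesis
      by eventually_elim auto
  qed
  show ?thesis
  proof (rule that)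
    show "prob_space lim" by (rule P.prob_space_axioms)
    show "AE \<omega> in lim. \<forall>n. \<pi> n (\<omega> (Suc n)) = \<omega> n"
      unfolding AE_all_countable using path by auto
  qed (auto simp: law)
qed

section \<open>The tree of net points and its dyadic contents\<close>

text \<open>The ratio 1/100 is so small that offsets accumulated over all deeper levels stay below
  the separation of the current one, and 10000000 is a generous bound for the ratio of any two balls
  compared below. The separation leaves at most one candidate \<open>w\<close> in the rule
  \<open>\<pi>_near\<close>.\<close>

locale regular_nets =
  fixes \<mu> :: "'a::polish_space measure" and \<theta> e D lam :: real and S :: "'a set"
    and V :: "nat \<Rightarrow> 'a set" and \<pi> :: "nat \<Rightarrow> 'a \<Rightarrow> 'a"
  assumes mms: "mms \<mu>" and \<theta>: "0 \<le> \<theta>" and e: "e = 1/100" and closed_S: "closed S" and S_ne: "S \<noteq> {}"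
    and V_sub: "V k \<subseteq> S" and V_countable: "countable (V k)"
    and V_sep: "z \<in> V k \<Longrightarrow> w \<in> V k \<Longrightarrow> z \<noteq> w \<Longrightarrow> e ^ k < dist z w"
    and V_net: "x \<in> S \<Longrightarrow> \<exists>z\<in>V k. dist x z \<le> e ^ k"
    and \<pi>_in: "z \<in> V (Suc k) \<Longrightarrow> \<pi> k z \<in> V k"
    and \<pi>_dist: "z \<in> V (Suc k) \<Longrightarrow> dist z (\<pi> k z) \<le> e ^ k"
    and \<pi>_near: "z \<in> V (Suc k) \<Longrightarrow> w \<in> V k \<Longrightarrow> dist z w < e ^ k / 2 \<Longrightarrow> \<pi> k z = w"
    and D: "1 \<le> D"
    and doubling: "0 < r \<Longrightarrow> r \<le> 1 \<Longrightarrow> measure \<mu> (cball x (10000000 * r)) \<le> D * measure \<mu> (cball x r)"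
    and lam: "0 < lam"
    and content_lower: "x \<in> S \<Longrightarrow> r \<in> {0<..1} \<Longrightarrow>
      ennreal lam * emeasure \<mu> (cball x r) / ennreal (r powr \<theta>) \<le> Hcont \<mu> \<theta> r (cball x r \<inter> S)"
begin

lemma e_pos[simp]: "0 < e ^ k" "0 \<le> e ^ k" and e_le_1: "e ^ k \<le> 1"
  using e by (auto intro: power_le_one)

lemma e_Suc[simp]: "e ^ Suc k = e ^ k / 100"
  using e by simp

declare power_Suc[simp del]

lemma e_mono: "j \<le> n \<Longrightarrow> e ^ n \<le> e ^ j"
  using e by (intro power_decreasing) auto

lemma e_less: "j < n \<Longrightarrow> e ^ n \<le> e ^ j / 100"
  using e_mono[of "Suc j" n] by simp

lemma anc_in: "z \<in> V n \<Longrightarrow> j \<le> n \<Longrightarrow> anc \<pi> n j z \<in> V j"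
  by (induction n arbitrary: z) (auto simp: \<pi>_in le_Suc_eq)

text \<open>The steps from level to level sum up geometrically, and 102/100 exceeds
  \<open>1 / (1 - e) = 100/99\<close>. The subtracted \<open>e ^ n\<close> is what lets the
  induction close.\<close>

lemma anc_dist':
  "z \<in> V n \<Longrightarrow> j \<le> n \<Longrightarrow> dist z (anc \<pi> n j z) \<le> 102/100 * (e ^ j - e ^ n)"
proof (induction n arbitrary: z)
  case (Suc n)
  show ?case
  proof (cases "j \<le> n")
    case True
    then have "dist (\<pi> n z) (anc \<pi> n j (\<pi> n z)) \<le> 102/100 * (e ^ j - e ^ n)"
      using Suc \<pi>_in by blast
    moreover have "dist z (\<pi> n z) \<le> e ^ n"
      using Suc \<pi>_dist by blast
    ultimately have "dist z (anc \<pi> n j (\<pi> n z)) \<le> e ^ n + 102/100 * (e ^ j - e ^ n)"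
      using dist_triangle[of z "anc \<pi> n j (\<pi> n z)" "\<pi> n z"] by linarith
    also have "\<dots> \<le> 102/100 * (e ^ j - e ^ Suc n)"
      using e_pos(1)[of n] unfolding e_Suc by argo
    finally show ?thesis using True by simp
  next
    case False
    then have "j = Suc n" using Suc by simp
    then show ?thesis by simp
  qed
qed simp

lemma anc_dist: "z \<in> V n \<Longrightarrow> j \<le> n \<Longrightarrow> dist z (anc \<pi> n j z) \<le> 102/100 * e ^ j"
  using anc_dist'[of z n j] e_pos(1)[of n] by argo

text \<open>The ancestor on level \<open>Suc j\<close> is displaced from \<open>z\<close> by little
  more than \<open>e ^ j / 100\<close>, so it is still within \<open>e ^ j / 2\<close> of
  \<open>w\<close> and the parent rule has to choose \<open>w\<close>.\<close>

lemma anc_near: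
  assumes "z \<in> V n" "j < n" "w \<in> V j" "dist z w \<le> e ^ j / 4"
  shows "anc \<pi> n j z = w"
proof -
  have y: "anc \<pi> n (Suc j) z \<in> V (Suc j)"
    using assms by (intro anc_in) auto
  have "dist (anc \<pi> n (Suc j) z) w \<le> dist z (anc \<pi> n (Suc j) z) + dist z w"
    by (rule dist_triangle3)
  also have "\<dots> \<le> 102/100 * e ^ Suc j + e ^ j / 4"
    using assms by (intro add_mono anc_dist) auto
  also have "\<dots> < e ^ j / 2"
    using e_pos(1)[of j] unfolding e_Suc by argo
  finally have "\<pi> j (anc \<pi> n (Suc j) z) = w"
    using y assms by (intro \<pi>_near) auto
  then show ?thesis
    using anc_parent[of j n \<pi> z] assms by simp
qed

text \<open>Disjointness of the cells is what the parent rule \<open>\<pi>_near\<close> is made for: a net point close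
  to a vertex descends from it.\<close>

definition Q :: "nat \<Rightarrow> 'a \<Rightarrow> 'a set" where
  "Q k z = (\<Union>j\<in>{k..}. \<Union>w\<in>{w\<in>V j. anc \<pi> j k w = z}. cball w (e ^ j / 10))"

lemma Q_borel[measurable]: "Q k z \<in> sets borel"
  unfolding Q_def
proof (intro sets.countable_UN'')
  show "countable {w \<in> V j. anc \<pi> j k w = z}" for j
    using V_countable[of j] by (rule countable_subset[rotated]) auto
qed auto

lemma Q_superset: "z \<in> V k \<Longrightarrow> cball z (e ^ k / 10) \<subseteq> Q k z"
  unfolding Q_def by force

lemma Q_subset: "Q k z \<subseteq> cball z (2 * e ^ k)"
proof
  fix x assume "x \<in> Q k z"
  then obtain j w where w: "k \<le> j" "w \<in> V j" "anc \<pi> j k w = z" "dist w x \<le> e ^ j / 10"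
    unfolding Q_def by auto
  then have "dist w z \<le> 102/100 * e ^ k"
    using anc_dist by blast
  then have "dist z x \<le> 102/100 * e ^ k + e ^ j / 10"
    using w(4) dist_triangle3[of z x w] by linarith
  also have "\<dots> \<le> 2 * e ^ k"
    using e_mono[OF w(1)] e_pos(1)[of k] by linarith
  finally show "x \<in> cball z (2 * e ^ k)" by simp
qed

text \<open>If two balls of the cells meet, their centres are closer than \<open>e ^ i / 4\<close>.
  On equal levels the separation makes them equal; otherwise the finer centre descends from the
  coarser one. In both cases the ancestors on level \<open>k\<close> coincide.\<close>

lemma Q_disjoint_aux:
  assumes "i \<le> j" "k \<le> i" "z' \<in> V i" "w' \<in> V j" "dist z' x \<le> e ^ i / 10" "dist w' x \<le> e ^ j / 10"
  shows "anc \<pi> i k z' = anc \<pi> j k w'"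
proof -
  have d: "dist w' z' \<le> e ^ i / 10 + e ^ j / 10"
    using assms dist_triangle2[of w' z' x] by linarith
  have "anc \<pi> j i w' = z'"
  proof (cases "i = j")
    case True
    have "z' = w'"
    proof (rule ccontr)
      assume "z' \<noteq> w'"
      then have "e ^ i < dist w' z'"
        using V_sep[of z' i w'] assms True by (simp add: dist_commute)
      moreover have "dist w' z' \<le> e ^ i / 5" using d True by simp
      ultimately show False using e_pos(1)[of i] by linarith
    qed
    then show ?thesis using True by simp
  next
    case False
    then have "i < j" using assms by simp
    then have "dist w' z' \<le> e ^ i / 4"
      using d e_less[of i j] e_pos(1)[of i] by linarith
    then show ?thesis
      using assms \<open>i < j\<close> by (intro anc_near) auto
  qed
  then show ?thesis
    using anc_anc[of k i j \<pi> w'] assms by simp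
qed

lemma Q_disjoint: "z \<noteq> w \<Longrightarrow> Q k z \<inter> Q k w = {}"
proof (rule ccontr)
  assume "z \<noteq> w" "Q k z \<inter> Q k w \<noteq> {}"
  then obtain x where x: "x \<in> Q k z" "x \<in> Q k w" by blast
  obtain i z' where "k \<le> i" "z' \<in> V i" "anc \<pi> i k z' = z" "dist z' x \<le> e ^ i / 10"
    using x(1) unfolding Q_def by auto
  moreover obtain j w' where "k \<le> j" "w' \<in> V j" "anc \<pi> j k w' = w" "dist w' x \<le> e ^ j / 10"
    using x(2) unfolding Q_def by auto
  ultimately show False
    using \<open>z \<noteq> w\<close> Q_disjoint_aux[of i j k z' w' x] Q_disjoint_aux[of j i k w' z' x] by (cases "i \<le> j") auto
qed

lemma Q_unique: "x \<in> Q k z \<Longrightarrow> x \<in> Q k w \<Longrightarrow> z = w"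
  using Q_disjoint[of z w k] by blast

lemma Q_nested: "z \<in> V (Suc k) \<Longrightarrow> Q (Suc k) z \<subseteq> Q k (\<pi> k z)"
  unfolding Q_def
proof safe
  fix x j w assume *: "Suc k \<le> j" "w \<in> V j" "x \<in> cball w (e ^ j / 10)"
  then have "anc \<pi> j k w = \<pi> k (anc \<pi> j (Suc k) w)"
    by (intro anc_parent) auto
  with * show "x \<in> (\<Union>j'\<in>{k..}. \<Union>w'\<in>{w'\<in>V j'. anc \<pi> j' k w' = \<pi> k (anc \<pi> j (Suc k) w)}. cball w' (e ^ j' / 10))"
    by (intro UN_I[of j] UN_I[of w]) auto
qed

lemma cball_ratio:
  assumes "0 < r" "r \<le> 1" "dist x y + s \<le> 10000000 * r"
  shows "measure \<mu> (cball y s) \<le> D * measure \<mu> (cball x r)"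
proof -
  have "measure \<mu> (cball y s) \<le> measure \<mu> (cball x (10000000 * r))"
  proof (rule mms_measure_mono[OF mms _ _ _ order_refl])
    show "cball y s \<subseteq> cball x (10000000 * r)"
      using assms(3) by (intro subsetI) (metis add_left_mono dist_triangle mem_cball order_trans)
  qed (use assms in auto)
  also have "\<dots> \<le> D * measure \<mu> (cball x r)"
    by (rule doubling) fact+
  finally show ?thesis .
qed

definition \<nu> :: "nat \<Rightarrow> 'a \<Rightarrow> real" where "\<nu> k z = measure \<mu> (Q k z)"

lemma emeasure_Q: "emeasure \<mu> (Q k z) = ennreal (\<nu> k z)"
proof -
  have "emeasure \<mu> (Q k z) \<le> emeasure \<mu> (cball z (2 * e ^ k))"
    using mms by (intro emeasure_mono Q_subset) (auto simp: mms_sets)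
  also have "\<dots> < top"
    using mms e_pos(1)[of k] by (simp add: mms_def)
  finally show ?thesis
    unfolding \<nu>_def by (intro emeasure_eq_ennreal_measure) auto
qed

lemma \<nu>_lower: "z \<in> V k \<Longrightarrow> measure \<mu> (cball z (e ^ k / 10)) \<le> \<nu> k z"
  unfolding \<nu>_def by (rule mms_measure_mono[OF mms _ _ _ Q_subset]) (auto intro: Q_superset[THEN subsetD])

lemma \<nu>_upper: "\<nu> k z \<le> measure \<mu> (cball z (2 * e ^ k))"
  unfolding \<nu>_def by (rule mms_measure_mono[OF mms _ _ Q_subset order_refl]) auto

lemma \<nu>_pos: "z \<in> V k \<Longrightarrow> 0 < \<nu> k z"
  using \<nu>_lower[of z k] mms_emeasure_cball(2)[OF mms, of "e ^ k / 10" z] e_pos(1)[of k] by fastforce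

lemma \<nu>_nonneg: "0 \<le> \<nu> k z"
  by (simp add: \<nu>_def)

definition ch :: "nat \<Rightarrow> 'a \<Rightarrow> 'a set" where "ch k z = {w \<in> V (Suc k). \<pi> k w = z}"

text \<open>The cells of the children are disjoint and lie in the cell of the parent, so no constant
  is lost. Finite subfamilies come first because the finiteness of \<open>ch k z\<close> is deduced
  from this bound.\<close>

lemma sum_\<nu>_le:
  assumes "finite F" "F \<subseteq> ch k z"
  shows "(\<Sum>w\<in>F. \<nu> (Suc k) w) \<le> \<nu> k z"
proof -
  have fin: "Q (Suc k) w \<in> fmeasurable \<mu>" for w
    using mms emeasure_Q[of "Suc k" w] by (auto simp: fmeasurable_def mms_sets)
  have "(\<Sum>w\<in>F. \<nu> (Suc k) w) = measure \<mu> (\<Union>w\<in>F. Q (Suc k) w)"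
    unfolding \<nu>_def
    by (subst measure_UNION_AE[OF assms(1) fin]) (auto simp: pairwise_def intro!: AE_I2 dest: Q_unique)
  also have "\<dots> \<le> \<nu> k z"
    unfolding \<nu>_def
  proof (rule mms_measure_mono[OF mms _ _ _ Q_subset])
    show "(\<Union>w\<in>F. Q (Suc k) w) \<subseteq> Q k z"
      using Q_nested assms(2) unfolding ch_def by blast
  qed (use assms in \<open>auto intro!: sets.finite_UN\<close>)
  finally show ?thesis .
qed

text \<open>A packing argument: by doubling, every child has a cell of measure at least
  \<open>c\<close>, and the total of these measures is at most that of the parent cell.\<close>

lemma finite_ch: "finite (ch k z)"
proof (rule ccontr)
  assume inf: "infinite (ch k z)"
  then obtain w0 where w0: "w0 \<in> ch k z" by (metis finite.emptyI ex_in_conv)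
  define c where "c = measure \<mu> (cball z (e ^ k)) / D"
  have c: "0 < c"
    unfolding c_def using D mms_emeasure_cball(2)[OF mms, of "e ^ k" z] by simp
  have lower: "c \<le> \<nu> (Suc k) w" if "w \<in> ch k z" for w
  proof -
    have w: "w \<in> V (Suc k)" "dist w z \<le> e ^ k"
      using that \<pi>_dist unfolding ch_def by auto
    have "measure \<mu> (cball z (e ^ k)) \<le> D * measure \<mu> (cball w (e ^ Suc k / 10))"
      using w(2) e_le_1[of k] e_pos(1)[of k] unfolding e_Suc by (intro cball_ratio) linarith+
    also have "\<dots> \<le> D * \<nu> (Suc k) w"
      using D w(1) by (intro mult_left_mono \<nu>_lower) auto
    finally show ?thesis
      unfolding c_def using D by (simp add: field_simps)
  qed
  obtain N where N: "\<nu> k z < of_nat N * c"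
    using reals_Archimedean3[OF c] by auto
  obtain F where F: "F \<subseteq> ch k z" "finite F" "card F = N"
    using infinite_arbitrarily_large[OF inf] by metis
  have "of_nat N * c = (\<Sum>w\<in>F. c)" using F by simp
  also have "\<dots> \<le> (\<Sum>w\<in>F. \<nu> (Suc k) w)"
    using F by (intro sum_mono lower) auto
  also have "\<dots> \<le> \<nu> k z"
    by (rule sum_\<nu>_le) fact+
  finally show False using N by simp
qed

text \<open>The next net has a point within \<open>e ^ Suc k\<close> of \<open>z\<close>, and the
  parent rule makes it a child of \<open>z\<close>. Paths therefore never get stuck.\<close>

lemma ch_nonempty: "z \<in> V k \<Longrightarrow> ch k z \<noteq> {}"
proof -
  assume z: "z \<in> V k"
  then obtain w where w: "w \<in> V (Suc k)" "dist z w \<le> e ^ Suc k"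
    using V_net[of z "Suc k"] V_sub[of k] by auto
  then have "dist w z < e ^ k / 2"
    using e_pos(1)[of k] dist_commute[of w z] unfolding e_Suc by linarith
  then have "\<pi> k w = z"
    using w z by (intro \<pi>_near) auto
  then show ?thesis using w by (auto simp: ch_def)
qed

definition q :: real where "q = e powr \<theta>"

lemma q: "0 < q" "q \<le> 1"
  using e \<theta> unfolding q_def by (auto intro!: powr_le1)

lemma q_power: "(e ^ k) powr \<theta> = q ^ k"
  using e unfolding q_def by (simp add: powr_power powr_powr mult_ac flip: powr_realpow)

definition h :: "nat \<Rightarrow> 'a \<Rightarrow> real" where "h k z = \<nu> k z / q ^ k"

lemma h_pos: "z \<in> V k \<Longrightarrow> 0 < h k z" and h_nonneg: "0 \<le> h k z"
  using \<nu>_pos q \<nu>_nonneg unfolding h_def by auto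

text \<open>The factor \<open>1 / q\<close> comes only from the change of normalisation between two
  levels. Every later bound on quotients of densities rests on this inequality being free of further
  constants.\<close>

lemma sum_h_le: "(\<Sum>w\<in>ch k z. h (Suc k) w) \<le> h k z / q"
  using sum_\<nu>_le[OF finite_ch order_refl, of k z] q
  unfolding h_def sum_divide_distrib[symmetric] by (simp add: field_simps power_Suc)

text \<open>The dyadic content of the part of \<open>S\<close> below a vertex, with coverings restricted to the
  first \<open>n\<close> generations of descendants, and its limit.\<close>

primrec al :: "nat \<Rightarrow> nat \<Rightarrow> 'a \<Rightarrow> real" where
  "al 0 k z = h k z"
| "al (Suc n) k z = min (h k z) (\<Sum>w\<in>ch k z. al n (Suc k) w)"

lemma al_nonneg: "0 \<le> al n k z"
  by (induction n arbitrary: k z) (auto simp: h_nonneg intro: sum_nonneg)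

lemma al_decseq: "al (Suc n) k z \<le> al n k z"
proof (induction n arbitrary: k z)
  case (Suc n)
  have "(\<Sum>w\<in>ch k z. al (Suc n) (Suc k) w) \<le> (\<Sum>w\<in>ch k z. al n (Suc k) w)"
    by (intro sum_mono Suc)
  then show ?case unfolding al.simps(2)[of "Suc n" k z] al.simps(2)[of n k z] by (intro min.mono order_refl)
qed simp

definition a :: "nat \<Rightarrow> 'a \<Rightarrow> real" where "a k z = lim (\<lambda>n. al n k z)"

lemma al_tendsto: "(\<lambda>n. al n k z) \<longlonglongrightarrow> a k z"
proof -
  obtain L where "(\<lambda>n. al n k z) \<longlonglongrightarrow> L"
    by (rule decseq_convergent[of "\<lambda>n. al n k z" 0]) (auto intro: decseq_SucI al_decseq al_nonneg)
  then show ?thesis unfolding a_def by (metis limI)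
qed

lemma a_eq: "a k z = min (h k z) (\<Sum>w\<in>ch k z. a (Suc k) w)"
proof (rule LIMSEQ_unique)
  show "(\<lambda>n. al (Suc n) k z) \<longlonglongrightarrow> a k z"
    by (rule LIMSEQ_Suc[OF al_tendsto])
  show "(\<lambda>n. al (Suc n) k z) \<longlonglongrightarrow> min (h k z) (\<Sum>w\<in>ch k z. a (Suc k) w)"
    by (simp, intro tendsto_min tendsto_sum al_tendsto tendsto_const)
qed

lemma a_le_h: "a k z \<le> h k z"
  unfolding a_eq[of k z] by simp

text \<open>Only covering matters, so the sets of different vertices may overlap. Working with net
  points of level \<open>k + n\<close> instead of limits of paths turns the comparison with
  \<open>Hcont\<close> into an induction on \<open>n\<close>.\<close>

definition near :: "nat \<Rightarrow> nat \<Rightarrow> 'a \<Rightarrow> 'a set" where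
  "near n k z = {x \<in> S. \<exists>y\<in>V (k + n). anc \<pi> (k + n) k y = z \<and> dist x y \<le> e ^ (k + n)}"

lemma near_subset_cball: "near n k z \<subseteq> cball z (3 * e ^ k)"
proof
  fix x assume "x \<in> near n k z"
  then obtain y where y: "y \<in> V (k + n)" "anc \<pi> (k + n) k y = z" "dist x y \<le> e ^ (k + n)"
    by (auto simp: near_def)
  then have "dist y z \<le> 102/100 * e ^ k"
    using anc_dist[of y "k + n" k] by auto
  then have "dist x z \<le> 3 * e ^ k"
    using y(3) e_mono[of k "k + n"] dist_triangle[of x z y] e_pos(1)[of k] by linarith
  then show "x \<in> cball z (3 * e ^ k)" by (simp add: dist_commute)
qed

lemma near_Suc: "near (Suc n) k z \<subseteq> (\<Union>w\<in>ch k z. near n (Suc k) w)"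
proof
  fix x assume "x \<in> near (Suc n) k z"
  then obtain y where y: "x \<in> S" "y \<in> V (k + Suc n)" "anc \<pi> (k + Suc n) k y = z" "dist x y \<le> e ^ (k + Suc n)"
    by (auto simp: near_def)
  define w where "w = anc \<pi> (k + Suc n) (Suc k) y"
  have "w \<in> V (Suc k)"
    unfolding w_def using y by (intro anc_in) auto
  moreover have "\<pi> k w = z"
    unfolding w_def using y anc_parent[of k "k + Suc n" \<pi> y] by simp
  ultimately have "w \<in> ch k z" by (simp add: ch_def)
  moreover have "x \<in> near n (Suc k) w"
    using y unfolding near_def w_def by auto
  ultimately show "x \<in> (\<Union>w\<in>ch k z. near n (Suc k) w)" by blast
qed

lemma Hcont_near_single:
  assumes "z \<in> V k" "3 * e ^ k < r"
  shows "Hcont \<mu> \<theta> r (near n k z) \<le> ennreal (D * h k z)"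
proof -
  have r0: "0 < 3 * e ^ k" by simp
  have "Hcont \<mu> \<theta> r (near n k z) \<le> emeasure \<mu> (cball z (3 * e ^ k)) / ennreal ((3 * e ^ k) powr \<theta>)"
    using assms by (intro Hcont_single near_subset_cball) auto
  also have "\<dots> = ennreal (measure \<mu> (cball z (3 * e ^ k)) / (3 * e ^ k) powr \<theta>)"
    unfolding mms_emeasure_cball(1)[OF mms r0] using r0 by (intro divide_ennreal) (simp_all only: measure_nonneg powr_gt_zero)
  also have "\<dots> \<le> ennreal (D * h k z)"
  proof (rule ennreal_leI)
    have "measure \<mu> (cball z (3 * e ^ k)) \<le> D * measure \<mu> (cball z (e ^ k / 10))"
      using e_le_1[of k] e_pos(1)[of k] by (intro cball_ratio) simp_all
    also have "\<dots> \<le> D * \<nu> k z"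
      using D assms by (intro mult_left_mono \<nu>_lower) auto
    finally have 1: "measure \<mu> (cball z (3 * e ^ k)) \<le> D * \<nu> k z" .
    have "q ^ k \<le> (3 * e ^ k) powr \<theta>"
      unfolding q_power[symmetric] using \<theta> e_pos(1)[of k] by (intro powr_mono2) auto
    with 1 have "measure \<mu> (cball z (3 * e ^ k)) / (3 * e ^ k) powr \<theta> \<le> D * \<nu> k z / q ^ k"
      using q D \<nu>_nonneg[of k z] by (intro frac_le) auto
    then show "measure \<mu> (cball z (3 * e ^ k)) / (3 * e ^ k) powr \<theta> \<le> D * h k z"
      by (simp add: h_def)
  qed
  finally show ?thesis .
qed

text \<open>The recursion of \<open>al\<close> mirrors two ways of covering: the first argument of
  \<open>min\<close> is one ball around \<open>z\<close>, the second joins coverings for the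
  finitely many children by subadditivity. All radii are \<open>3 * e ^ j\<close> with
  \<open>j \<ge> k\<close> and so stay below \<open>r\<close>.\<close>

lemma Hcont_near:
  assumes "z \<in> V k" "3 * e ^ k < r"
  shows "Hcont \<mu> \<theta> r (near n k z) \<le> ennreal (D * al n k z)"
  using assms
proof (induction n arbitrary: k z)
  case 0
  then show ?case using Hcont_near_single by simp
next
  case (Suc n)
  have r: "3 * e ^ Suc k < r"
    using Suc.prems(2) e_pos(1)[of k] unfolding e_Suc by linarith
  have "Hcont \<mu> \<theta> r (near (Suc n) k z) \<le> Hcont \<mu> \<theta> r (\<Union>w\<in>ch k z. near n (Suc k) w)"
    by (intro Hcont_mono near_Suc)
  also have "\<dots> \<le> (\<Sum>w\<in>ch k z. Hcont \<mu> \<theta> r (near n (Suc k) w))"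
    by (intro Hcont_UN finite_ch)
  also have "\<dots> \<le> (\<Sum>w\<in>ch k z. ennreal (D * al n (Suc k) w))"
    using Suc.prems(2) r by (intro sum_mono Suc.IH) (auto simp: ch_def simp del: e_Suc)
  also have "\<dots> = ennreal (D * (\<Sum>w\<in>ch k z. al n (Suc k) w))"
    using D by (subst sum_ennreal) (auto simp: sum_distrib_left al_nonneg)
  finally have "Hcont \<mu> \<theta> r (near (Suc n) k z) \<le> ennreal (D * (\<Sum>w\<in>ch k z. al n (Suc k) w))" .
  moreover have "Hcont \<mu> \<theta> r (near (Suc n) k z) \<le> ennreal (D * h k z)"
    by (intro Hcont_near_single Suc)
  ultimately show ?case
    by (simp add: min_def)
qed

text \<open>In the constant, 1 takes care of the alternative \<open>h k z\<close> of the minimum and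
  \<open>lam / D\<^sup>2\<close> of the sum over the children. One factor \<open>D\<close> is from
  \<open>Hcont_near\<close>, the other from comparing the cell with
  \<open>cball z r\<close>.\<close>

lemma al_lower:
  assumes "z \<in> V k"
  shows "min 1 (lam / D\<^sup>2) * h k z \<le> al (Suc n) k z"
proof -
  \<comment> \<open>Together with the net error \<open>e ^ k / 100\<close> this radius stays below
    the \<open>e ^ k / 4\<close> of \<open>anc_near\<close>, and it exceeds the radius
    \<open>3 * e ^ Suc k\<close> of the balls used for the children.\<close>
  define r where "r = e ^ k / 5"
  have r: "0 < r" "r \<le> 1" "3 * e ^ Suc k < r"
    using e_le_1[of k] e_pos(1)[of k] unfolding r_def by auto
  have "cball z r \<inter> S \<subseteq> (\<Union>w\<in>ch k z. near n (Suc k) w)"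
  proof (rule order_trans[OF _ near_Suc], safe)
    fix x assume x: "x \<in> cball z r" "x \<in> S"
    obtain y where y: "y \<in> V (k + Suc n)" "dist x y \<le> e ^ (k + Suc n)"
      using V_net[OF x(2)] by blast
    have "dist y z \<le> dist z x + dist x y"
      by (metis dist_commute dist_triangle)
    also have "\<dots> \<le> e ^ k / 5 + e ^ k / 100"
      using x y e_less[of k "k + Suc n"] by (intro add_mono) (auto simp: r_def)
    also have "\<dots> \<le> e ^ k / 4" by simp
    finally have "anc \<pi> (k + Suc n) k y = z"
      using y assms by (intro anc_near) auto
    with x y show "x \<in> near (Suc n) k z"
      by (auto simp: near_def)
  qed
  then have "Hcont \<mu> \<theta> r (cball z r \<inter> S) \<le> Hcont \<mu> \<theta> r (\<Union>w\<in>ch k z. near n (Suc k) w)"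
    by (rule Hcont_mono)
  also have "\<dots> \<le> (\<Sum>w\<in>ch k z. Hcont \<mu> \<theta> r (near n (Suc k) w))"
    by (intro Hcont_UN finite_ch)
  also have "\<dots> \<le> (\<Sum>w\<in>ch k z. ennreal (D * al n (Suc k) w))"
    using r by (intro sum_mono Hcont_near) (auto simp: ch_def)
  also have "\<dots> = ennreal (D * (\<Sum>w\<in>ch k z. al n (Suc k) w))"
    using D by (subst sum_ennreal) (auto simp: sum_distrib_left al_nonneg)
  finally have "ennreal lam * emeasure \<mu> (cball z r) / ennreal (r powr \<theta>) \<le> ennreal (D * (\<Sum>w\<in>ch k z. al n (Suc k) w))"
    using content_lower[of z r] assms V_sub[of k] r by force
  then have "ennreal (lam * measure \<mu> (cball z r) / r powr \<theta>) \<le> ennreal (D * (\<Sum>w\<in>ch k z. al n (Suc k) w))"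
    using r lam by (simp add: mms_emeasure_cball(1)[OF mms] divide_ennreal flip: ennreal_mult')
  then have 1: "lam * measure \<mu> (cball z r) / r powr \<theta> \<le> D * (\<Sum>w\<in>ch k z. al n (Suc k) w)"
    using D by (subst (asm) ennreal_le_iff) (auto intro!: mult_nonneg_nonneg sum_nonneg al_nonneg)
  have "\<nu> k z \<le> D * measure \<mu> (cball z r)"
    using r e_pos(1)[of k] by (intro order_trans[OF \<nu>_upper cball_ratio]) (simp_all add: r_def)
  moreover have "r powr \<theta> \<le> q ^ k"
    unfolding q_power[symmetric] using \<theta> r by (intro powr_mono2) (auto simp: r_def)
  ultimately have "\<nu> k z / q ^ k \<le> (D * measure \<mu> (cball z r)) / r powr \<theta>"
    using r D by (intro frac_le) auto
  then have "lam / D * h k z \<le> lam / D * ((D * measure \<mu> (cball z r)) / r powr \<theta>)"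
    unfolding h_def using lam D by (intro mult_left_mono) auto
  also have "\<dots> \<le> D * (\<Sum>w\<in>ch k z. al n (Suc k) w)"
    using 1 D by simp
  finally have "lam / D\<^sup>2 * h k z \<le> (\<Sum>w\<in>ch k z. al n (Suc k) w)"
    using D by (simp add: field_simps power2_eq_square)
  moreover have "min 1 (lam / D\<^sup>2) * h k z \<le> 1 * h k z" "min 1 (lam / D\<^sup>2) * h k z \<le> lam / D\<^sup>2 * h k z"
    by (intro mult_right_mono h_nonneg min.cobounded1, intro mult_right_mono h_nonneg min.cobounded2)
  ultimately show ?thesis
    by simp
qed

definition c0 :: real where "c0 = min 1 (lam / D\<^sup>2)"

lemma c0: "0 < c0"
  using lam D by (simp add: c0_def)

lemma a_lower: "z \<in> V k \<Longrightarrow> c0 * h k z \<le> a k z"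
  unfolding c0_def by (rule LIMSEQ_le_const[OF LIMSEQ_Suc[OF al_tendsto]]) (auto intro: al_lower simp del: al.simps)

lemma a_pos: "z \<in> V k \<Longrightarrow> 0 < a k z"
  using a_lower[of z k] c0 h_pos[of z k] by (metis less_le_trans mult_pos_pos)

definition \<sigma> :: "nat \<Rightarrow> 'a \<Rightarrow> real" where "\<sigma> k z = (\<Sum>w\<in>ch k z. a (Suc k) w)"

lemma \<sigma>_pos: "z \<in> V k \<Longrightarrow> 0 < \<sigma> k z"
  unfolding \<sigma>_def using finite_ch ch_nonempty by (intro sum_pos) (auto simp: ch_def intro: a_pos)

lemma a_le_\<sigma>: "a k z \<le> \<sigma> k z"
  using a_eq[of k z] unfolding \<sigma>_def by linarith

text \<open>If the minimum in \<open>a_eq\<close> is \<open>h k z\<close>, the children are bounded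
  by \<open>sum_h_le\<close>; otherwise \<open>a k z = \<sigma> k z\<close>, and
  \<open>q \<le> 1\<close> suffices.\<close>

lemma \<sigma>_le:
  assumes "z \<in> V k" shows "\<sigma> k z \<le> a k z / q"
proof (cases "a k z = h k z")
  case True
  have "\<sigma> k z \<le> (\<Sum>w\<in>ch k z. h (Suc k) w)"
    unfolding \<sigma>_def by (intro sum_mono a_le_h)
  with True sum_h_le[of k z] show ?thesis by simp
next
  case False
  then have "a k z = \<sigma> k z"
    using a_eq[of k z] unfolding \<sigma>_def by (simp add: min_def split: if_splits)
  then show ?thesis
    using q \<sigma>_pos[OF assms] by (simp add: field_simps)
qed

end

section \<open>The Markov chain descending the tree and its densities\<close>

context regular_nets
begin

definition child_pmf :: "nat \<Rightarrow> 'a \<Rightarrow> 'a pmf" where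
  "child_pmf n z = embed_pmf (\<lambda>w. if w \<in> ch n z then a (Suc n) w / \<sigma> n z else 0)"

lemma pmf_child_pmf:
  assumes "z \<in> V n"
  shows "pmf (child_pmf n z) w = (if w \<in> ch n z then a (Suc n) w / \<sigma> n z else 0)"
  unfolding child_pmf_def
proof (rule pmf_embed_pmf)
  have ch: "0 < a (Suc n) w" if "w \<in> ch n z" for w
    using that a_pos by (auto simp: ch_def)
  show "0 \<le> (if w \<in> ch n z then a (Suc n) w / \<sigma> n z else 0)" for w
    using ch[of w] \<sigma>_pos[OF assms] by (auto intro: less_imp_le)
  have "(\<integral>\<^sup>+ w. ennreal (if w \<in> ch n z then a (Suc n) w / \<sigma> n z else 0) \<partial>count_space UNIV)
      = (\<Sum>w\<in>ch n z. ennreal (if w \<in> ch n z then a (Suc n) w / \<sigma> n z else 0))"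
    using finite_ch by (intro nn_integral_count_space') auto
  also have "\<dots> = (\<Sum>w\<in>ch n z. ennreal (a (Suc n) w / \<sigma> n z))"
    by (intro sum.cong) auto
  also have "\<dots> = ennreal (\<Sum>w\<in>ch n z. a (Suc n) w / \<sigma> n z)"
    using ch \<sigma>_pos[OF assms] by (intro sum_ennreal) (auto intro: less_imp_le)
  also have "(\<Sum>w\<in>ch n z. a (Suc n) w / \<sigma> n z) = 1"
    using \<sigma>_pos[OF assms] by (simp add: \<sigma>_def flip: sum_divide_distrib)
  finally show "(\<integral>\<^sup>+ w. ennreal (if w \<in> ch n z then a (Suc n) w / \<sigma> n z else 0) \<partial>count_space UNIV) = 1"
    by simp
qed

lemma set_child_pmf:
  assumes "z \<in> V n" shows "set_pmf (child_pmf n z) = ch n z"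
proof -
  have "a (Suc n) w / \<sigma> n z \<noteq> 0" if "w \<in> ch n z" for w
    using that a_pos[of w "Suc n"] \<sigma>_pos[OF assms] by (auto simp: ch_def)
  then show ?thesis
    by (auto simp: set_pmf_eq pmf_child_pmf[OF assms])
qed

text \<open>The root law may be any probability charging all of the possibly infinite set
  \<open>V 0\<close>, since \<open>g\<close> divides it out again; a geometric law along an
  enumeration is one. Full support on every level keeps these divisions legitimate.\<close>

primrec p :: "nat \<Rightarrow> 'a pmf" where
  "p 0 = map_pmf (from_nat_into (V 0)) (geometric_pmf (1/2))"
| "p (Suc n) = bind_pmf (p n) (child_pmf n)"

lemma set_p: "set_pmf (p n) = V n"
proof (induction n)
  case 0
  have "V 0 \<noteq> {}" using S_ne V_net[of _ 0] by fastforce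
  then show ?case
    using V_countable[of 0] by (simp add: set_pmf_geometric range_from_nat_into)
next
  case (Suc n)
  have "set_pmf (p (Suc n)) = (\<Union>z\<in>V n. ch n z)"
    using Suc by (auto simp: set_child_pmf)
  also have "\<dots> = V (Suc n)"
    using \<pi>_in by (auto simp: ch_def)
  finally show ?case .
qed

lemma map_p: "map_pmf (\<pi> n) (p (Suc n)) = p n"
proof -
  have "map_pmf (\<pi> n) (p (Suc n)) = bind_pmf (p n) (\<lambda>z. map_pmf (\<pi> n) (child_pmf n z))"
    by (simp add: map_bind_pmf)
  also have "\<dots> = bind_pmf (p n) return_pmf"
  proof (rule bind_pmf_cong[OF refl])
    fix z assume "z \<in> set_pmf (p n)"
    then have z: "z \<in> V n" by (simp add: set_p)
    have "map_pmf (\<pi> n) (child_pmf n z) = map_pmf (\<lambda>_. z) (child_pmf n z)"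
      by (rule map_pmf_cong) (auto simp: set_child_pmf[OF z] ch_def)
    then show "map_pmf (\<pi> n) (child_pmf n z) = return_pmf z" by (simp add: map_pmf_const)
  qed
  finally show ?thesis by (simp add: bind_return_pmf')
qed

lemma pmf_p_pos: "z \<in> V n \<Longrightarrow> 0 < pmf (p n) z"
  by (simp add: pmf_positive set_p)

lemma pmf_p_Suc:
  assumes "w \<in> V (Suc n)"
  shows "pmf (p (Suc n)) w = pmf (p n) (\<pi> n w) * a (Suc n) w / \<sigma> n (\<pi> n w)"
proof -
  have "pmf (p (Suc n)) w = (\<integral>z. pmf (child_pmf n z) w \<partial>measure_pmf (p n))"
    by (simp add: pmf_bind)
  also have "\<dots> = (\<Sum>z\<in>{\<pi> n w}. pmf (child_pmf n z) w * pmf (p n) z)"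
    by (rule integral_measure_pmf_real) (auto simp: set_p pmf_child_pmf ch_def split: if_splits)
  also have "\<dots> = pmf (p n) (\<pi> n w) * a (Suc n) w / \<sigma> n (\<pi> n w)"
    using assms \<pi>_in[OF assms] by (simp add: pmf_child_pmf ch_def)
  finally show ?thesis .
qed

text \<open>This is the density, with respect to the law of the random path, of the path measure
  that gives mass \<open>a n z\<close> to the paths through \<open>z\<close>. It vanishes off a
  countable set and hence is Borel.\<close>

definition g :: "nat \<Rightarrow> 'a \<Rightarrow> real" where
  "g n z = (if z \<in> V n then a n z / pmf (p n) z else 0)"

lemma g_nonneg: "0 \<le> g n z"
  using a_pos[of z n] by (auto simp: g_def intro: less_imp_le)

lemma g_pmf: "z \<in> V n \<Longrightarrow> g n z * pmf (p n) z = a n z"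
  using pmf_p_pos[of z n] by (simp add: g_def)

text \<open>The weight \<open>a (Suc n) w\<close> cancels against the transition probability. With
  \<open>z = \<pi> n w\<close>, the quotient of consecutive densities is therefore
  \<open>\<sigma> n z / a n z\<close>, the same for all children of \<open>z\<close>.\<close>

lemma g_step:
  assumes "w \<in> V (Suc n)"
  shows "g n (\<pi> n w) \<le> g (Suc n) w" "g (Suc n) w \<le> g n (\<pi> n w) / q"
proof -
  let ?z = "\<pi> n w"
  have z: "?z \<in> V n" by (rule \<pi>_in) fact
  have g: "g (Suc n) w = \<sigma> n ?z / pmf (p n) ?z"
    using a_pos[OF assms] assms by (simp add: g_def pmf_p_Suc del: p.simps)
  show "g n ?z \<le> g (Suc n) w"
    unfolding g using z a_le_\<sigma> pmf_p_pos[OF z] by (simp add: g_def divide_right_mono)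
  have "\<sigma> n ?z / pmf (p n) ?z \<le> (a n ?z / q) / pmf (p n) ?z"
    using \<sigma>_le[OF z] pmf_p_pos[OF z] by (intro divide_right_mono) auto
  then show "g (Suc n) w \<le> g n ?z / q"
    unfolding g using z by (simp add: g_def mult.commute)
qed

lemma g_borel[measurable]: "g n \<in> borel_measurable borel"
  by (rule measurable_discrete_difference[where f="\<lambda>_. 0" and X="V n"]) (auto simp: V_countable g_def)

end

section \<open>Measures on the paths and their images\<close>

locale regular_nets_path = regular_nets +
  fixes P :: "(nat \<Rightarrow> 'a) measure"
  assumes prob_P: "prob_space P" and sets_P: "sets P = sets (PiM UNIV (\<lambda>_. borel))"
    and law: "\<And>n A. A \<in> sets borel \<Longrightarrow> emeasure P {\<omega>. \<omega> n \<in> A} = emeasure (measure_pmf (p n)) A"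
    and path: "AE \<omega> in P. \<forall>n. \<pi> n (\<omega> (Suc n)) = \<omega> n"
begin

interpretation P: prob_space P by (rule prob_P)

lemma space_P[simp]: "space P = UNIV"
  using sets_eq_imp_space_eq[OF sets_P] by (simp add: space_PiM)

lemma coord[measurable]: "(\<lambda>\<omega>. \<omega> n) \<in> borel_measurable P"
  by (subst measurable_cong_sets[OF sets_P refl]) (rule measurable_component_singleton, simp)

lemma V_borel[measurable]: "V n \<in> sets borel"
  using V_countable by (auto intro: sets.countable)

text \<open>The existential over the countable set \<open>V (Suc n)\<close> makes the condition
  measurable although nothing is known about the measurability of \<open>\<pi> n\<close>.\<close>

definition good :: "(nat \<Rightarrow> 'a) \<Rightarrow> bool" where
  "good \<omega> \<longleftrightarrow> (\<forall>n. \<omega> n \<in> V n \<and> (\<exists>w\<in>V (Suc n). \<omega> (Suc n) = w \<and> \<pi> n w = \<omega> n))"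

lemma good_sets[measurable]: "Measurable.pred P good"
proof -
  have "{\<omega> \<in> space P. \<exists>w\<in>V (Suc n). \<omega> (Suc n) = w \<and> \<pi> n w = \<omega> n} \<in> sets P" for n
  proof -
    have "{\<omega> \<in> space P. \<exists>w\<in>V (Suc n). \<omega> (Suc n) = w \<and> \<pi> n w = \<omega> n}
        = (\<Union>w\<in>V (Suc n). {\<omega> \<in> space P. \<omega> (Suc n) = w \<and> \<pi> n w = \<omega> n})"
      by auto
    also have "\<dots> \<in> sets P"
      using V_countable[of "Suc n"] by (intro sets.countable_UN'') (auto simp del: space_P)
    finally show ?thesis .
  qed
  then have [measurable]: "Measurable.pred P (\<lambda>\<omega>. \<exists>w\<in>V (Suc n). \<omega> (Suc n) = w \<and> \<pi> n w = \<omega> n)" for n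
    by (simp add: pred_def)
  show ?thesis unfolding good_def by measurable
qed

lemma AE_good: "AE \<omega> in P. good \<omega>"
proof -
  have "AE \<omega> in P. \<omega> n \<in> V n" for n
  proof (rule P.AE_I_eq_1)
    have "emeasure (measure_pmf (p n)) (V n) = 1"
      using measure_pmf.emeasure_space_1 by (simp add: emeasure_pmf flip: set_p)
    then show "emeasure P {\<omega> \<in> space P. \<omega> n \<in> V n} = 1"
      using law[of "V n" n] by simp
  qed measurable
  then have "AE \<omega> in P. \<forall>n. \<omega> n \<in> V n"
    by (simp add: AE_all_countable)
  with path show ?thesis
    by eventually_elim (auto simp: good_def)
qed

lemma good_V: "good \<omega> \<Longrightarrow> \<omega> n \<in> V n"
  by (simp add: good_def)

lemma good_\<pi>: "good \<omega> \<Longrightarrow> \<pi> n (\<omega> (Suc n)) = \<omega> n"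
  unfolding good_def by metis

lemma good_anc: "good \<omega> \<Longrightarrow> j \<le> n \<Longrightarrow> anc \<pi> n j (\<omega> n) = \<omega> j"
  by (induction n) (auto simp: good_\<pi> le_Suc_eq)

lemma good_dist: "good \<omega> \<Longrightarrow> j \<le> n \<Longrightarrow> dist (\<omega> n) (\<omega> j) \<le> 102/100 * e ^ j"
  using anc_dist[of "\<omega> n" n j] good_anc[of \<omega> j n] good_V by auto

lemma good_convergent: assumes "good \<omega>" shows "convergent \<omega>"
proof -
  have "Cauchy \<omega>"
  proof (rule metric_CauchyI)
    fix \<epsilon> :: real assume "0 < \<epsilon>"
    then obtain j where j: "e ^ j < \<epsilon> / 3"
      using real_arch_pow_inv[of "\<epsilon>/3" e] e by auto
    have "dist (\<omega> m) (\<omega> n) < \<epsilon>" if "m \<ge> j" "n \<ge> j" for m n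
    proof -
      have "dist (\<omega> m) (\<omega> n) \<le> 102/100 * e ^ j + 102/100 * e ^ j"
        using good_dist[OF assms that(1)] good_dist[OF assms that(2)] dist_triangle2[of "\<omega> m" "\<omega> n" "\<omega> j"] by linarith
      then show ?thesis using j \<open>0 < \<epsilon>\<close> by linarith
    qed
    then show "\<exists>M. \<forall>m\<ge>M. \<forall>n\<ge>M. dist (\<omega> m) (\<omega> n) < \<epsilon>" by blast
  qed
  then show ?thesis by (rule Cauchy_convergent)
qed

text \<open>The default value for the null set of bad paths is a point of \<open>S\<close>, so that
  \<open>\<phi>\<close> maps into \<open>S\<close> without exception.\<close>

definition \<phi> :: "(nat \<Rightarrow> 'a) \<Rightarrow> 'a" where
  "\<phi> \<omega> = (if good \<omega> then lim \<omega> else (SOME x. x \<in> S))"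

lemma \<phi>_tendsto: "good \<omega> \<Longrightarrow> \<omega> \<longlonglongrightarrow> \<phi> \<omega>"
  using good_convergent by (simp add: \<phi>_def convergent_LIMSEQ_iff)

lemma \<phi>_dist: assumes "good \<omega>" shows "dist (\<omega> j) (\<phi> \<omega>) \<le> 2 * e ^ j"
proof -
  have "dist (\<phi> \<omega>) (\<omega> j) \<le> 102/100 * e ^ j"
    by (rule LIMSEQ_le_const2[OF tendsto_dist[OF \<phi>_tendsto[OF assms] tendsto_const]])
      (use good_dist[OF assms] in blast)
  then show ?thesis
    unfolding dist_commute[of "\<omega> j"] using e_pos(1)[of j] by linarith
qed

lemma \<phi>_in: "\<phi> \<omega> \<in> S"
proof (cases "good \<omega>")
  case True
  then show ?thesis
    using closed_sequentially[OF closed_S _ \<phi>_tendsto] good_V V_sub by blast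
next
  case False
  then show ?thesis using S_ne by (simp add: \<phi>_def some_in_eq)
qed

lemma \<phi>_borel[measurable]: "\<phi> \<in> borel_measurable P"
proof (rule borel_measurable_LIMSEQ_metric)
  show "(\<lambda>\<omega>. if good \<omega> then \<omega> n else (SOME x. x \<in> S)) \<in> borel_measurable P" for n
    by measurable
  show "(\<lambda>n. if good \<omega> then \<omega> n else (SOME x. x \<in> S)) \<longlonglongrightarrow> \<phi> \<omega>" for \<omega>
  proof (cases "good \<omega>")
    case True
    then show ?thesis using \<phi>_tendsto by simp
  qed (simp add: \<phi>_def)
qed

definition M :: "nat \<Rightarrow> 'a measure" where
  "M k = distr (density P (\<lambda>\<omega>. ennreal (g k (\<omega> k)))) borel \<phi>"

lemma sets_M[simp, measurable_cong]: "sets (M k) = sets borel" and space_M[simp]: "space (M k) = UNIV"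
  by (simp_all add: M_def)

lemma emeasure_M:
  assumes [measurable]: "A \<in> sets borel"
  shows "emeasure (M k) A = (\<integral>\<^sup>+\<omega>. ennreal (g k (\<omega> k)) * indicator A (\<phi> \<omega>) \<partial>P)"
proof -
  have "\<phi> \<in> measurable (density P (\<lambda>\<omega>. ennreal (g k (\<omega> k)))) borel" by simp
  moreover have "\<phi> -` A \<in> sets P" using measurable_sets[OF \<phi>_borel assms] by simp
  ultimately show ?thesis
    unfolding M_def by (subst emeasure_distr) (auto simp: emeasure_density intro!: nn_integral_cong split: split_indicator)
qed

lemma good_g_mono: "good \<omega> \<Longrightarrow> g k (\<omega> k) \<le> g (k + j) (\<omega> (k + j))"
proof (induction j)
  case (Suc j)
  then show ?case
    using g_step(1)[OF good_V[of \<omega> "Suc (k + j)"]] good_\<pi>[of \<omega> "k + j"] by simp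
qed simp

lemma good_g_upper: "good \<omega> \<Longrightarrow> g (k + j) (\<omega> (k + j)) \<le> g k (\<omega> k) / q ^ j"
proof (induction j)
  case (Suc j)
  have "g (k + Suc j) (\<omega> (k + Suc j)) \<le> g (k + j) (\<omega> (k + j)) / q"
    using g_step(2)[OF good_V[of \<omega> "Suc (k + j)"]] good_\<pi>[of \<omega> "k + j"] Suc by simp
  also have "\<dots> \<le> (g k (\<omega> k) / q ^ j) / q"
    using Suc q by (intro divide_right_mono) auto
  finally show ?case by (simp add: power_Suc mult.commute)
qed simp

lemma M_mono:
  assumes [measurable]: "A \<in> sets borel"
  shows "k \<le> l \<Longrightarrow> emeasure (M k) A \<le> emeasure (M l) A"
  unfolding emeasure_M[OF assms]
  by (intro nn_integral_mono_AE, use AE_good in eventually_elim)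
    (auto intro!: mult_right_mono ennreal_leI dest!: good_g_mono[of _ k "l - k"])

lemma M_upper:
  assumes [measurable]: "A \<in> sets borel"
  shows "emeasure (M (k + j)) A \<le> ennreal (1 / q ^ j) * emeasure (M k) A"
proof -
  have "emeasure (M (k + j)) A \<le> (\<integral>\<^sup>+\<omega>. ennreal (1 / q ^ j) * (ennreal (g k (\<omega> k)) * indicator A (\<phi> \<omega>)) \<partial>P)"
    unfolding emeasure_M[OF assms]
  proof (intro nn_integral_mono_AE, use AE_good in eventually_elim)
    case (elim \<omega>)
    then have "ennreal (g (k + j) (\<omega> (k + j))) \<le> ennreal (1 / q ^ j) * ennreal (g k (\<omega> k))"
      using good_g_upper[OF elim, of k j] q by (subst ennreal_mult'[symmetric]) (auto intro: ennreal_leI)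
    then show ?case by (auto split: split_indicator)
  qed
  also have "\<dots> = ennreal (1 / q ^ j) * emeasure (M k) A"
    unfolding emeasure_M[OF assms] by (intro nn_integral_cmult) measurable
  finally show ?thesis .
qed

lemma nn_integral_coord:
  assumes [measurable]: "f \<in> borel_measurable borel"
  shows "(\<integral>\<^sup>+\<omega>. f (\<omega> k) \<partial>P) = (\<integral>\<^sup>+z. f z \<partial>measure_pmf (p k))"
proof -
  have eq: "distr P borel (\<lambda>\<omega>. \<omega> k) = distr (measure_pmf (p k)) borel (\<lambda>z. z)"
  proof (rule measure_eqI)
    fix A assume "A \<in> sets (distr P borel (\<lambda>\<omega>. \<omega> k))"
    then have [measurable]: "A \<in> sets borel" by simp
    have "{\<omega>. \<omega> k \<in> A} = (\<lambda>\<omega>. \<omega> k) -` A" by auto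
    then show "emeasure (distr P borel (\<lambda>\<omega>. \<omega> k)) A = emeasure (distr (measure_pmf (p k)) borel (\<lambda>z. z)) A"
      using law[of A k] by (simp add: emeasure_distr)
  qed simp
  have "(\<integral>\<^sup>+\<omega>. f (\<omega> k) \<partial>P) = (\<integral>\<^sup>+z. f z \<partial>distr P borel (\<lambda>\<omega>. \<omega> k))"
    by (simp add: nn_integral_distr)
  also have "\<dots> = (\<integral>\<^sup>+z. f z \<partial>measure_pmf (p k))"
    unfolding eq by (subst nn_integral_distr) auto
  finally show ?thesis .
qed

lemma nn_integral_g:
  assumes [measurable]: "B \<in> sets borel"
  shows "(\<integral>\<^sup>+\<omega>. ennreal (g k (\<omega> k)) * indicator B (\<omega> k) \<partial>P) = (\<integral>\<^sup>+z. ennreal (a k z) \<partial>count_space (V k \<inter> B))"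
proof -
  have "(\<integral>\<^sup>+\<omega>. ennreal (g k (\<omega> k)) * indicator B (\<omega> k) \<partial>P) = (\<integral>\<^sup>+z. ennreal (g k z) * indicator B z \<partial>measure_pmf (p k))"
    by (rule nn_integral_coord) measurable
  also have "\<dots> = (\<integral>\<^sup>+z. ennreal (pmf (p k) z) * (ennreal (g k z) * indicator B z) \<partial>count_space UNIV)"
    by (rule nn_integral_measure_pmf)
  also have "\<dots> = (\<integral>\<^sup>+z. ennreal (a k z) * indicator (V k \<inter> B) z \<partial>count_space UNIV)"
  proof (rule nn_integral_cong)
    fix z
    show "ennreal (pmf (p k) z) * (ennreal (g k z) * indicator B z) = ennreal (a k z) * indicator (V k \<inter> B) z"
    proof (cases "z \<in> V k")
      case True
      have "ennreal (pmf (p k) z) * ennreal (g k z) = ennreal (a k z)"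
        using g_pmf[OF True] by (subst ennreal_mult''[symmetric]) (auto simp: g_nonneg mult.commute)
      with True show ?thesis by (auto split: split_indicator)
    qed (simp add: g_def)
  qed
  also have "\<dots> = (\<integral>\<^sup>+z. ennreal (a k z) \<partial>count_space (V k \<inter> B))"
    by (simp add: nn_integral_count_space_indicator)
  finally show ?thesis .
qed

text \<open>Each \<open>a k z\<close> is at most \<open>\<mu> (Q k z) / q ^ k\<close>, and the cells
  are disjoint subsets of \<open>cball x s\<close>. Disjointness replaces any count of the
  vertices.\<close>

lemma sum_a_upper:
  assumes "\<And>z. z \<in> B \<Longrightarrow> cball z (2 * e ^ k) \<subseteq> cball x s" and s: "0 < s"
  shows "(\<integral>\<^sup>+z. ennreal (a k z) \<partial>count_space (V k \<inter> B)) \<le> ennreal (measure \<mu> (cball x s) / q ^ k)"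
proof -
  have [measurable_cong]: "sets \<mu> = sets borel" using mms by (rule mms_sets)
  have "(\<integral>\<^sup>+z. ennreal (a k z) \<partial>count_space (V k \<inter> B)) \<le> (\<integral>\<^sup>+z. ennreal (1 / q ^ k) * emeasure \<mu> (Q k z) \<partial>count_space (V k \<inter> B))"
  proof (rule nn_integral_mono)
    fix z
    have "ennreal (a k z) \<le> ennreal (h k z)"
      by (intro ennreal_leI a_le_h)
    also have "\<dots> = ennreal (1 / q ^ k) * emeasure \<mu> (Q k z)"
      using q by (simp add: h_def emeasure_Q flip: ennreal_mult')
    finally show "ennreal (a k z) \<le> ennreal (1 / q ^ k) * emeasure \<mu> (Q k z)" .
  qed
  also have "\<dots> = ennreal (1 / q ^ k) * (\<integral>\<^sup>+z. emeasure \<mu> (Q k z) \<partial>count_space (V k \<inter> B))"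
    by (rule nn_integral_cmult) simp
  also have "(\<integral>\<^sup>+z. emeasure \<mu> (Q k z) \<partial>count_space (V k \<inter> B)) = emeasure \<mu> (\<Union>z\<in>V k \<inter> B. Q k z)"
    using V_countable[of k] by (intro emeasure_UN_countable[symmetric]) (auto simp: disjoint_family_on_def Q_disjoint)
  also have "\<dots> \<le> emeasure \<mu> (cball x s)"
  proof (rule emeasure_mono)
    show "(\<Union>z\<in>V k \<inter> B. Q k z) \<subseteq> cball x s"
      using assms(1) Q_subset by blast
  qed measurable
  also have "\<dots> = ennreal (measure \<mu> (cball x s))"
    by (rule mms_emeasure_cball[OF mms s])
  finally show ?thesis
    using q by (simp add: mult_left_mono flip: ennreal_mult')
qed

end

section \<open>Densities of an increasing sequence of comparable measures\<close>

lemma regular_densities: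
  fixes m :: "nat \<Rightarrow> 'a measure" and q :: real
  assumes sf: "sigma_finite_measure (m 0)" and sets: "\<And>k. sets (m k) = sets (m 0)" and q: "0 < q"
    and lower: "\<And>k j A. A \<in> sets (m 0) \<Longrightarrow> emeasure (m k) A \<le> emeasure (m (k + j)) A"
    and upper: "\<And>k j A. A \<in> sets (m 0) \<Longrightarrow> emeasure (m (k + j)) A \<le> ennreal (1 / q ^ j) * emeasure (m k) A"
  obtains w :: "nat \<Rightarrow> 'a \<Rightarrow> real" where
    "\<And>k. w k \<in> borel_measurable (m 0)" "\<And>k. AE x in m 0. \<bar>w k x\<bar> \<le> 1 / q ^ k" "\<And>k. AE x in m 0. 0 \<le> w k x"
    "\<And>k. m k = density (m 0) (\<lambda>x. ennreal (w k x))"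
    "\<And>k j. AE x in m 0. q ^ j \<le> w k x / w (k + j) x \<and> w k x / w (k + j) x \<le> 1"
proof -
  interpret sigma_finite_measure "m 0" by (rule sf)
  have "\<exists>f\<in>borel_measurable (m 0). density (m 0) f = m k" for k
  proof (rule Radon_Nikodym)
    show "absolutely_continuous (m 0) (m k)"
      unfolding absolutely_continuous_def
    proof
      fix A assume A: "A \<in> null_sets (m 0)"
      then have "emeasure (m k) A \<le> 0"
        using upper[OF null_setsD2[OF A], of 0 k] by (simp add: null_setsD1[OF A])
      with A show "A \<in> null_sets (m k)"
        by (auto simp: null_sets_def sets[of k])
    qed
  qed (rule sets)
  then obtain f where f[measurable]: "\<And>k. f k \<in> borel_measurable (m 0)" and dens: "\<And>k. density (m 0) (f k) = m k"
    by metis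
  have mono: "AE x in m 0. f k x \<le> f (k + j) x" for k j
    using lower by (intro AE_le_of_density_le) (auto simp: dens)
  have bound: "AE x in m 0. f (k + j) x \<le> ennreal (1 / q ^ j) * f k x" for k j
  proof (rule AE_le_of_density_le)
    fix A assume A: "A \<in> sets (m 0)"
    have "emeasure (density (m 0) (\<lambda>x. ennreal (1 / q ^ j) * f k x)) A
        = (\<integral>\<^sup>+x. ennreal (1 / q ^ j) * (f k x * indicator A x) \<partial>m 0)"
      unfolding mult.assoc[symmetric] using A by (intro emeasure_density) measurable
    also have "\<dots> = ennreal (1 / q ^ j) * emeasure (density (m 0) (f k)) A"
    proof -
      have "(\<lambda>x. f k x * indicator A x) \<in> borel_measurable (m 0)" using A by measurable
      then show ?thesis
        unfolding emeasure_density[OF f[of k] A] by (rule nn_integral_cmult)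
    qed
    finally have "emeasure (density (m 0) (\<lambda>x. ennreal (1 / q ^ j) * f k x)) A = ennreal (1 / q ^ j) * emeasure (m k) A"
      by (simp only: dens)
    then show "emeasure (density (m 0) (f (k + j))) A \<le> emeasure (density (m 0) (\<lambda>x. ennreal (1 / q ^ j) * f k x)) A"
      using upper[OF A, of k j] by (simp add: dens)
  qed measurable
  have one: "AE x in m 0. f 0 x = 1"
    using dens[of 0] by (intro density_unique) (auto simp: density_1)
  have upper_f: "AE x in m 0. f k x \<le> ennreal (1 / q ^ k)" for k
    using bound[of 0 k] one by eventually_elim simp
  define w where "w k x = enn2real (f k x)" for k x
  have w: "AE x in m 0. f k x = ennreal (w k x)" for k
    using upper_f[of k] by eventually_elim (auto simp: w_def ennreal_enn2real_if top_unique)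
  \<comment> \<open>Monotonicity against the density 1 of \<open>m 0\<close> keeps the denominators
    of the quotients away from 0.\<close>
  have pos: "AE x in m 0. 1 \<le> w k x" for k
    using mono[of 0 k] one w[of k]
  proof eventually_elim
    case (elim x)
    then have "ennreal 1 \<le> ennreal (w k x)" by simp
    then show ?case by (subst (asm) ennreal_le_iff) (auto simp: w_def)
  qed
  show ?thesis
  proof (rule that[of w])
    show "w k \<in> borel_measurable (m 0)" for k
      unfolding w_def by measurable
    show "AE x in m 0. \<bar>w k x\<bar> \<le> 1 / q ^ k" for k
      using upper_f[of k] w[of k]
    proof eventually_elim
      case (elim x)
      then have "ennreal (w k x) \<le> ennreal (1 / q ^ k)" by simp
      then have "w k x \<le> 1 / q ^ k" using q by (subst (asm) ennreal_le_iff) auto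
      then show ?case by (simp add: w_def)
    qed
    show "AE x in m 0. 0 \<le> w k x" for k
      by (simp add: w_def)
    show "m k = density (m 0) (\<lambda>x. ennreal (w k x))" for k
      unfolding dens[symmetric, of k] by (rule density_cong[OF f _ w]) (simp add: w_def)
    show "AE x in m 0. q ^ j \<le> w k x / w (k + j) x \<and> w k x / w (k + j) x \<le> 1" for k j
      using mono[of k j] bound[of k j] w[of k] w[of "k + j"] pos[of k] pos[of "k + j"]
    proof eventually_elim
      case (elim x)
      have "ennreal (w k x) \<le> ennreal (w (k + j) x)" using elim by simp
      then have 1: "w k x \<le> w (k + j) x"
        using elim by (subst (asm) ennreal_le_iff) auto
      have "0 \<le> 1 / q ^ j * w k x" using elim q by simp
      moreover have "ennreal (w (k + j) x) \<le> ennreal (1 / q ^ j * w k x)"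
      proof -
        have eq: "ennreal (1 / q ^ j * w k x) = ennreal (1 / q ^ j) * ennreal (w k x)"
          using elim q by (intro ennreal_mult) auto
        show ?thesis unfolding eq using elim(2,3,4) by simp
      qed
      ultimately have 2: "w (k + j) x \<le> 1 / q ^ j * w k x"
        by (simp only: ennreal_le_iff)
      have "0 < w (k + j) x" using elim by linarith
      with 1 2 q show ?case
        by (simp add: field_simps)
    qed
  qed
qed

section \<open>Ball estimates and supports of the image measures\<close>

context regular_nets_path
begin

interpretation P: prob_space P by (rule prob_P)

lemma M_cball_upper:
  assumes r: "0 < r" "r \<le> e ^ k"
  shows "emeasure (M (Suc k)) (cball x r) \<le> ennreal (D / q) * emeasure \<mu> (cball x r) / ennreal (r powr \<theta>)"
proof -
  \<comment> \<open>The first level strictly finer than \<open>r\<close>. With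
    \<open>r \<le> e ^ k\<close> the strictness gives \<open>k < n\<close>, so
    \<open>M (Suc k)\<close> is dominated by \<open>M n\<close>, and the cells of level
    \<open>n\<close> have size comparable to \<open>r\<close>.\<close>
  define n where "n = (LEAST n. e ^ n < r)"
  have ex: "\<exists>n. e ^ n < r"
    by (rule real_arch_pow_inv) (use r e in simp_all)
  then have n: "e ^ n < r" unfolding n_def by (rule LeastI_ex)
  have "k < n"
    using n r(2) e_mono[of n k] by (cases "n \<le> k") auto
  then obtain j where j: "n = Suc j" "k \<le> j"
    by (cases n) auto
  have rj: "r \<le> e ^ j"
    using not_less_Least[of j "\<lambda>n. e ^ n < r"] j unfolding n_def[symmetric] by (simp add: not_less)
  let ?s = "r + 2 * e ^ n"
  have "emeasure (M (Suc k)) (cball x r) \<le> emeasure (M n) (cball x r)"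
    using j by (intro M_mono) auto
  also have "\<dots> = (\<integral>\<^sup>+\<omega>. ennreal (g n (\<omega> n)) * indicator (cball x r) (\<phi> \<omega>) \<partial>P)"
    by (rule emeasure_M) simp
  also have "\<dots> \<le> (\<integral>\<^sup>+\<omega>. ennreal (g n (\<omega> n)) * indicator (cball x ?s) (\<omega> n) \<partial>P)"
  proof (intro nn_integral_mono_AE, use AE_good in eventually_elim)
    case (elim \<omega>)
    have "dist x (\<omega> n) \<le> dist x (\<phi> \<omega>) + 2 * e ^ n"
      using \<phi>_dist[OF elim, of n] dist_triangle2[of x "\<omega> n" "\<phi> \<omega>"] by linarith
    then show ?case by (auto split: split_indicator)
  qed
  also have "\<dots> = (\<integral>\<^sup>+z. ennreal (a n z) \<partial>count_space (V n \<inter> cball x ?s))"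
    by (rule nn_integral_g) simp
  also have "\<dots> \<le> ennreal (measure \<mu> (cball x (5 * r)) / q ^ n)"
  proof (rule sum_a_upper)
    fix z assume z: "z \<in> cball x ?s"
    show "cball z (2 * e ^ n) \<subseteq> cball x (5 * r)"
    proof
      fix y assume "y \<in> cball z (2 * e ^ n)"
      then have "dist x y \<le> ?s + 2 * e ^ n"
        using z dist_triangle[of x y z] by simp
      then show "y \<in> cball x (5 * r)" using n by simp
    qed
  qed (use r in simp)
  also have "\<dots> \<le> ennreal (D / q * measure \<mu> (cball x r) / r powr \<theta>)"
  proof (rule ennreal_leI)
    have 1: "measure \<mu> (cball x (5 * r)) \<le> D * measure \<mu> (cball x r)"
      using r e_le_1[of k] by (intro cball_ratio) auto
    \<comment> \<open>Since \<open>r\<close> lies between the scales of the consecutive levels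
      \<open>n\<close> and \<open>j\<close>, replacing \<open>q ^ n\<close> by
      \<open>r powr \<theta>\<close> costs one factor \<open>1 / q\<close>.\<close>
    have "r powr \<theta> \<le> q ^ j"
      unfolding q_power[symmetric] using r rj \<theta> by (intro powr_mono2) auto
    then have "r powr \<theta> * q \<le> q ^ n"
      using q j by (simp add: power_Suc mult.commute)
    then have "measure \<mu> (cball x (5 * r)) / q ^ n \<le> D * measure \<mu> (cball x r) / (r powr \<theta> * q)"
      using 1 q r D by (intro frac_le) auto
    then show "measure \<mu> (cball x (5 * r)) / q ^ n \<le> D / q * measure \<mu> (cball x r) / r powr \<theta>"
      by (simp add: mult.commute)
  qed
  also have "\<dots> = ennreal (D / q) * emeasure \<mu> (cball x r) / ennreal (r powr \<theta>)"
    using r D q by (simp add: mms_emeasure_cball(1)[OF mms] divide_ennreal flip: ennreal_mult')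
  finally show ?thesis .
qed

lemma M_cball_finite:
  assumes "0 < r" "r \<le> e ^ k"
  shows "emeasure (M (Suc k)) (cball x r) < \<infinity>"
proof -
  have "ennreal (D / q) * emeasure \<mu> (cball x r) / ennreal (r powr \<theta>) = ennreal (D / q * measure \<mu> (cball x r) / r powr \<theta>)"
    using assms D q by (simp add: mms_emeasure_cball(1)[OF mms] divide_ennreal flip: ennreal_mult')
  then show ?thesis
    using M_cball_upper[OF assms, of x] by (metis ennreal_less_top infinity_ennreal_def le_less_trans)
qed

text \<open>Almost every path through \<open>z\<close> ends within \<open>2 * e ^ n\<close> of
  \<open>z\<close>, so \<open>M n\<close> puts the full mass \<open>a n z\<close> into
  \<open>A\<close>; later measures only add to it.\<close>

lemma M_cylinder_lower:
  assumes z: "z \<in> V n" and A[measurable]: "A \<in> sets borel" and sub: "cball z (2 * e ^ n) \<subseteq> A" and k: "n \<le> k"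
  shows "ennreal (a n z) \<le> emeasure (M k) A"
proof -
  have "ennreal (a n z) = (\<integral>\<^sup>+y. ennreal (a n y) \<partial>count_space (V n \<inter> {z}))"
    using z by (simp add: nn_integral_count_space_finite)
  also have "\<dots> = (\<integral>\<^sup>+\<omega>. ennreal (g n (\<omega> n)) * indicator {z} (\<omega> n) \<partial>P)"
    by (rule nn_integral_g[symmetric]) simp
  also have "\<dots> \<le> (\<integral>\<^sup>+\<omega>. ennreal (g n (\<omega> n)) * indicator A (\<phi> \<omega>) \<partial>P)"
  proof (intro nn_integral_mono_AE, use AE_good in eventually_elim)
    case (elim \<omega>)
    have "\<omega> n = z \<Longrightarrow> \<phi> \<omega> \<in> A"
      using \<phi>_dist[OF elim, of n] sub by auto
    then show ?case by (auto split: split_indicator)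
  qed
  also have "\<dots> = emeasure (M n) A"
    by (rule emeasure_M[symmetric]) simp
  also have "\<dots> \<le> emeasure (M k) A"
    by (rule M_mono) (use k in auto)
  finally show ?thesis .
qed

lemma M_cball_lower:
  assumes x: "x \<in> S" and r: "e ^ k \<le> r" "r \<le> 1"
  shows "ennreal (c0 / D) * emeasure \<mu> (cball x r) / ennreal (r powr \<theta>) \<le> emeasure (M (Suc k)) (cball x r)"
proof -
  have r0: "0 < r" using r(1) e_pos(1)[of k] by linarith
  \<comment> \<open>The coarsest scale not exceeding \<open>r\<close>; minimality gives
    \<open>r \<le> 100 * e ^ j\<close>, with \<open>r \<le> 1\<close> serving for
    \<open>j = 0\<close>. The vertex is then taken one level deeper, on level \<open>Suc j\<close>,
    so that the endpoints of its paths fit into \<open>cball x r\<close>.\<close>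
  define j where "j = (LEAST j. e ^ j \<le> r)"
  have j: "e ^ j \<le> r" "j \<le> k"
    unfolding j_def using r(1) by (rule LeastI, rule Least_le)
  have rj: "r \<le> 100 * e ^ j"
  proof (cases j)
    case (Suc i)
    then have "r < e ^ i"
      using not_less_Least[of i "\<lambda>j. e ^ j \<le> r"] unfolding j_def[symmetric] by simp
    with Suc show ?thesis by simp
  qed (use r in simp)
  obtain z where z: "z \<in> V (Suc j)" "dist x z \<le> e ^ Suc j"
    using V_net[OF x] by blast
  have "ennreal (c0 / D * measure \<mu> (cball x r) / r powr \<theta>) \<le> ennreal (a (Suc j) z)"
  proof (rule ennreal_leI)
    have "measure \<mu> (cball x r) \<le> D * measure \<mu> (cball z (e ^ Suc j / 10))"
      using z(2) rj e_le_1[of j] e_pos(1)[of j] unfolding e_Suc dist_commute[of x z]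
      by (intro cball_ratio) linarith+
    also have "\<dots> \<le> D * \<nu> (Suc j) z"
      using D z by (intro mult_left_mono \<nu>_lower) auto
    finally have 1: "measure \<mu> (cball x r) / D \<le> \<nu> (Suc j) z"
      using D by (simp add: field_simps)
    have "q ^ Suc j \<le> q ^ j" using q by (intro power_decreasing) auto
    also have "q ^ j \<le> r powr \<theta>"
      unfolding q_power[symmetric] using j \<theta> e_pos(2)[of j] by (intro powr_mono2) auto
    finally have "measure \<mu> (cball x r) / D / r powr \<theta> \<le> \<nu> (Suc j) z / q ^ Suc j"
      using 1 q \<nu>_nonneg by (intro frac_le) auto
    then have "c0 * (measure \<mu> (cball x r) / D / r powr \<theta>) \<le> c0 * h (Suc j) z"
      unfolding h_def using c0 by (intro mult_left_mono) auto
    also have "\<dots> \<le> a (Suc j) z" by (rule a_lower) fact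
    finally show "c0 / D * measure \<mu> (cball x r) / r powr \<theta> \<le> a (Suc j) z"
      by (simp add: mult.commute)
  qed
  also have "\<dots> \<le> emeasure (M (Suc k)) (cball x r)"
  proof (rule M_cylinder_lower[OF z(1)])
    show "cball z (2 * e ^ Suc j) \<subseteq> cball x r"
    proof
      fix y assume "y \<in> cball z (2 * e ^ Suc j)"
      then have "dist x y \<le> e ^ Suc j + 2 * e ^ Suc j"
        using z dist_triangle[of x y z] by (simp del: e_Suc)
      then show "y \<in> cball x r" using j e_pos(1)[of j] unfolding e_Suc mem_cball by linarith
    qed
  qed (use j in auto)
  also have "ennreal (c0 / D * measure \<mu> (cball x r) / r powr \<theta>) = ennreal (c0 / D) * emeasure \<mu> (cball x r) / ennreal (r powr \<theta>)"
    using r0 D c0 by (simp add: mms_emeasure_cball(1)[OF mms] divide_ennreal flip: ennreal_mult')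
  finally show ?thesis .
qed

lemma support_M: "support (M k) = S"
proof (intro equalityI subsetI)
  fix x assume x: "x \<in> support (M k)"
  show "x \<in> S"
  proof (rule ccontr)
    assume "x \<notin> S"
    then obtain r where r: "0 < r" "ball x r \<subseteq> - S"
      using closed_S open_contains_ball[of "- S"] by auto
    have "indicator (cball x (r / 2)) (\<phi> \<omega>) = (0::ennreal)" for \<omega>
    proof -
      have "\<phi> \<omega> \<notin> ball x r" using r(2) \<phi>_in[of \<omega>] by blast
      then have "\<phi> \<omega> \<notin> cball x (r / 2)" using r(1) by simp
      then show ?thesis by simp
    qed
    then have "emeasure (M k) (cball x (r / 2)) = 0"
      by (simp add: emeasure_M)
    with x r(1) show False unfolding support_def by (metis (mono_tags) half_gt_zero mem_Collect_eq less_irrefl)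
  qed
next
  fix x assume x: "x \<in> S"
  show "x \<in> support (M k)"
    unfolding support_def
  proof (intro CollectI allI impI)
    fix r :: real assume r: "0 < r"
    then obtain i where i: "e ^ i < r / 3"
      using real_arch_pow_inv[of "r / 3" e] e by auto
    have ir: "e ^ (i + k) < r / 3" using i e_mono[of i "i + k"] by simp
    obtain z where z: "z \<in> V (i + k)" "dist x z \<le> e ^ (i + k)"
      using V_net[OF x] by blast
    have "cball z (2 * e ^ (i + k)) \<subseteq> cball x r"
    proof
      fix y assume "y \<in> cball z (2 * e ^ (i + k))"
      then have "dist x y \<le> e ^ (i + k) + 2 * e ^ (i + k)"
        using z dist_triangle[of x y z] by simp
      then show "y \<in> cball x r" using ir by simp
    qed
    then have "ennreal (a (i + k) z) \<le> emeasure (M (k + i)) (cball x r)"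
      using z by (intro M_cylinder_lower) (auto simp: add.commute)
    \<comment> \<open>A vertex small enough for the ball exists only on a deep level; comparability
      of the measures carries positivity back to level \<open>k\<close>.\<close>
    also have "\<dots> \<le> ennreal (1 / q ^ i) * emeasure (M k) (cball x r)"
      by (rule M_upper) simp
    finally show "0 < emeasure (M k) (cball x r)"
      using a_pos[OF z(1)] by (metis ennreal_eq_0_iff le_zero_eq linorder_not_le mult_zero_right zero_less_iff_neq_zero)
  qed
qed

lemma sigma_finite_M: "sigma_finite_measure (M (Suc k))"
proof
  obtain C :: "'a set" where C: "countable C" "\<And>X. open X \<Longrightarrow> X \<noteq> {} \<Longrightarrow> \<exists>d\<in>C. d \<in> X"
    using countable_dense_exists by blast
  show "\<exists>A. countable A \<and> A \<subseteq> sets (M (Suc k)) \<and> \<Union>A = space (M (Suc k)) \<and> (\<forall>a\<in>A. emeasure (M (Suc k)) a \<noteq> \<infinity>)"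
  proof (intro exI conjI ballI)
    show "countable ((\<lambda>c. cball c (e ^ k)) ` C)" using C by simp
    show "(\<lambda>c. cball c (e ^ k)) ` C \<subseteq> sets (M (Suc k))" by auto
    have "x \<in> (\<Union>c\<in>C. cball c (e ^ k))" for x
    proof -
      have "ball x (e ^ k) \<noteq> {}"
        using centre_in_ball[of x "e ^ k"] e_pos(1)[of k] by blast
      then obtain c where "c \<in> C" "dist x c < e ^ k"
        using C(2)[of "ball x (e ^ k)"] by auto
      then show ?thesis
        by (intro UN_I[of c]) (simp_all add: dist_commute)
    qed
    then show "\<Union>((\<lambda>c. cball c (e ^ k)) ` C) = space (M (Suc k))" by auto
    show "emeasure (M (Suc k)) A \<noteq> \<infinity>" if "A \<in> (\<lambda>c. cball c (e ^ k)) ` C" for A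
      using that M_cball_finite[OF e_pos(1) order_refl] by (auto simp: less_top)
  qed
qed

section \<open>Upper densities\<close>

text \<open>The conditional probability of ending in \<open>E\<close>, given the vertex
  \<open>z\<close> on level \<open>k\<close>, is at most 1/2; the product form avoids a
  quotient.\<close>

definition half :: "'a set \<Rightarrow> nat \<Rightarrow> 'a \<Rightarrow> bool" where
  "half E k z \<longleftrightarrow> 2 * emeasure P {\<omega>. \<omega> k = z \<and> \<phi> \<omega> \<in> E} \<le> emeasure P {\<omega>. \<omega> k = z}"

text \<open>A weak form of the martingale convergence theorem for the filtration of the levels of the tree.\<close>

lemma null_of_half:
  assumes A[measurable]: "A \<in> sets borel" and E[measurable]: "E \<in> sets borel" and "A \<subseteq> E"
    and half: "\<And>\<omega>. good \<omega> \<Longrightarrow> \<phi> \<omega> \<in> A \<Longrightarrow> eventually (\<lambda>k. half E k (\<omega> k)) sequentially"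
  shows "AE \<omega> in P. \<phi> \<omega> \<notin> A"
proof -
  have preds[measurable]: "Measurable.pred P (\<lambda>\<omega>. \<omega> n = z)" "Measurable.pred P (\<lambda>\<omega>. \<phi> \<omega> \<in> X)"
    if "X \<in> sets borel" for n z X
    using that by measurable
  have P_sets: "{\<omega>. R \<omega>} \<in> sets P" if "Measurable.pred P R" for R
    using that by (simp add: pred_def)
  \<comment> \<open>Outer regularity is applied at the end: if every open superset of
    \<open>A\<close> has at least twice the mass of \<open>A\<close>, then \<open>A\<close> has at
    least twice its own finite mass and is null.\<close>
  have open_bound: "2 * emeasure P {\<omega>. good \<omega> \<and> \<phi> \<omega> \<in> A} \<le> emeasure P {\<omega>. \<phi> \<omega> \<in> U}" if U: "open U" "A \<subseteq> U" for U
  proof -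
    have U_borel[measurable]: "U \<in> sets borel" using U by simp
    define B where "B n = {z \<in> V n. half E n z \<and> cball z (2 * e ^ n) \<subseteq> U}" for n
    have B: "countable (B n)" for n
      using V_countable[of n] by (rule countable_subset[rotated]) (auto simp: B_def)
    then have [measurable]: "B n \<in> sets borel" for n
      by (auto intro: sets.countable)
    \<comment> \<open>These sets increase with \<open>n\<close>. They exhaust the good paths ending
      in \<open>A\<close>, because \<open>half\<close> holds eventually and the balls around
      \<open>\<omega> n\<close> eventually shrink into the open set \<open>U\<close>.\<close>
    define F where "F n = {\<omega>. good \<omega> \<and> \<phi> \<omega> \<in> A \<and> (\<forall>i\<in>{n..}. \<omega> i \<in> B i)}" for n
    have F_sets: "F n \<in> sets P" for n
      unfolding F_def by (rule P_sets) measurable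
    \<comment> \<open>Level \<open>n\<close> alone gives the bound: \<open>half E n\<close> is
      summed over the vertices in \<open>B n\<close>, and almost every path through such a vertex
      ends in \<open>U\<close>.\<close>
    have F_le: "2 * emeasure P (F n) \<le> emeasure P {\<omega>. \<phi> \<omega> \<in> U}" for n
    proof -
      have "emeasure P (F n) \<le> emeasure P (\<Union>z\<in>B n. {\<omega>. \<omega> n = z \<and> \<phi> \<omega> \<in> E})"
        using \<open>A \<subseteq> E\<close> B
        by (intro emeasure_mono sets.countable_UN'' P_sets) (auto simp: F_def)
      also have "\<dots> = (\<integral>\<^sup>+z. emeasure P {\<omega>. \<omega> n = z \<and> \<phi> \<omega> \<in> E} \<partial>count_space (B n))"
        using B by (intro emeasure_UN_countable P_sets) (auto simp: disjoint_family_on_def)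
      finally have "2 * emeasure P (F n) \<le> 2 * (\<integral>\<^sup>+z. emeasure P {\<omega>. \<omega> n = z \<and> \<phi> \<omega> \<in> E} \<partial>count_space (B n))"
        by (rule mult_left_mono) simp
      also have "\<dots> = (\<integral>\<^sup>+z. 2 * emeasure P {\<omega>. \<omega> n = z \<and> \<phi> \<omega> \<in> E} \<partial>count_space (B n))"
        by (rule nn_integral_cmult[symmetric]) simp
      also have "\<dots> \<le> (\<integral>\<^sup>+z. emeasure P {\<omega>. \<omega> n = z} \<partial>count_space (B n))"
        by (rule nn_integral_mono) (auto simp: B_def half_def)
      also have "\<dots> = emeasure P (\<Union>z\<in>B n. {\<omega>. \<omega> n = z})"
        using B by (intro emeasure_UN_countable[symmetric] P_sets) (auto simp: disjoint_family_on_def)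
      also have "(\<Union>z\<in>B n. {\<omega>. \<omega> n = z}) = {\<omega>. \<omega> n \<in> B n}" by auto
      also have "emeasure P {\<omega>. \<omega> n \<in> B n} \<le> emeasure P {\<omega>. \<phi> \<omega> \<in> U}"
      proof (rule emeasure_mono_AE)
        show "AE \<omega> in P. \<omega> \<in> {\<omega>. \<omega> n \<in> B n} \<longrightarrow> \<omega> \<in> {\<omega>. \<phi> \<omega> \<in> U}"
          using AE_good
        proof eventually_elim
          case (elim \<omega>)
          show ?case using \<phi>_dist[OF elim, of n] by (auto simp: B_def)
        qed
      qed (rule P_sets, measurable)
      finally show ?thesis .
    qed
    have "incseq F"
      by (auto simp: incseq_def F_def)
    then have "emeasure P (\<Union>n. F n) = (SUP n. emeasure P (F n))"
      using F_sets by (intro SUP_emeasure_incseq[symmetric]) auto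
    moreover have "(\<Union>n. F n) = {\<omega>. good \<omega> \<and> \<phi> \<omega> \<in> A}"
    proof (intro equalityI subsetI)
      fix \<omega> assume "\<omega> \<in> {\<omega>. good \<omega> \<and> \<phi> \<omega> \<in> A}"
      then have \<omega>: "good \<omega>" "\<phi> \<omega> \<in> A" by auto
      obtain \<delta> where \<delta>: "0 < \<delta>" "ball (\<phi> \<omega>) \<delta> \<subseteq> U"
        using U \<omega> by (meson open_contains_ball subsetD)
      obtain i where i: "e ^ i < \<delta> / 4"
        using real_arch_pow_inv[of "\<delta> / 4" e] \<delta> e by auto
      obtain N where N: "\<And>n. N \<le> n \<Longrightarrow> half E n (\<omega> n)"
        using half[OF \<omega>] by (auto simp: eventually_sequentially)
      have "\<omega> n \<in> B n" if "n \<ge> max i N" for n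
      proof -
        have "cball (\<omega> n) (2 * e ^ n) \<subseteq> ball (\<phi> \<omega>) \<delta>"
        proof
          fix y assume "y \<in> cball (\<omega> n) (2 * e ^ n)"
          then have "dist (\<phi> \<omega>) y \<le> 2 * e ^ n + 2 * e ^ n"
            using \<phi>_dist[OF \<omega>(1), of n] dist_triangle3[of "\<phi> \<omega>" y "\<omega> n"] by simp
          then show "y \<in> ball (\<phi> \<omega>) \<delta>"
            using i e_mono[of i n] that by simp
        qed
        then show ?thesis
          using N[of n] that good_V[OF \<omega>(1)] \<delta> by (auto simp: B_def)
      qed
      then have "\<omega> \<in> F (max i N)"
        using \<omega> by (simp add: F_def)
      then show "\<omega> \<in> (\<Union>n. F n)" by blast
    qed (auto simp: F_def)
    ultimately have "2 * emeasure P {\<omega>. good \<omega> \<and> \<phi> \<omega> \<in> A} = (SUP n. 2 * emeasure P (F n))"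
      by (simp add: SUP_mult_left_ennreal)
    also have "\<dots> \<le> emeasure P {\<omega>. \<phi> \<omega> \<in> U}"
      by (intro SUP_least F_le)
    finally show ?thesis .
  qed
  define N where "N = distr P borel \<phi>"
  have N: "emeasure N X = emeasure P {\<omega>. \<phi> \<omega> \<in> X}" if "X \<in> sets borel" for X
    unfolding N_def using that by (subst emeasure_distr) (auto intro!: arg_cong[where f="emeasure P"])
  have "emeasure N (space N) \<noteq> \<infinity>"
    by (simp add: N N_def[THEN arg_cong[where f=space]])
  then have "emeasure N A = (INF U\<in>{U. A \<subseteq> U \<and> open U}. emeasure N U)"
    by (intro outer_regular) (auto simp: N_def)
  moreover have "2 * emeasure P {\<omega>. good \<omega> \<and> \<phi> \<omega> \<in> A} \<le> (INF U\<in>{U. A \<subseteq> U \<and> open U}. emeasure N U)"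
    by (rule INF_greatest) (auto simp: N intro: open_bound)
  moreover have "emeasure P {\<omega>. good \<omega> \<and> \<phi> \<omega> \<in> A} = emeasure P {\<omega>. \<phi> \<omega> \<in> A}"
    using AE_good by (intro emeasure_eq_AE P_sets) auto
  ultimately have "2 * emeasure P {\<omega>. \<phi> \<omega> \<in> A} \<le> emeasure P {\<omega>. \<phi> \<omega> \<in> A}"
    using N[OF A] by simp
  then have "emeasure P {\<omega>. \<phi> \<omega> \<in> A} = 0"
    using P.emeasure_finite[of "{\<omega>. \<phi> \<omega> \<in> A}"]
    by (cases "emeasure P {\<omega>. \<phi> \<omega> \<in> A}") (auto simp: ennreal_le_iff simp flip: ennreal_numeral ennreal_mult)
  then show ?thesis
    by (subst AE_iff_measurable[OF P_sets]) auto
qed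

end

section \<open>Positive upper densities and the strongly regular sequence\<close>

context regular_nets_path
begin

interpretation P: prob_space P by (rule prob_P)

definition \<rho> :: "'a set \<Rightarrow> nat \<Rightarrow> 'a \<Rightarrow> real" where
  "\<rho> E k x = measure (M (Suc k)) (cball x (e ^ k) \<inter> E) / measure (M (Suc k)) (cball x (e ^ k))"

lemma \<rho>_borel:
  assumes [measurable]: "E \<in> sets borel"
  shows "\<rho> E k \<in> borel_measurable borel"
proof -
  interpret sigma_finite_measure "M (Suc k)" by (rule sigma_finite_M)
  have meas[measurable]: "(\<lambda>x. emeasure (M (Suc k)) (cball x (e ^ k) \<inter> F)) \<in> borel_measurable borel"
    if [measurable]: "F \<in> sets borel" for F :: "'a set"
  proof (rule measurable_emeasure)
    have "{y \<in> space (borel \<Otimes>\<^sub>M M (Suc k)). snd y \<in> cball (fst y) (e ^ k) \<inter> F}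
        = {y \<in> space (borel \<Otimes>\<^sub>M M (Suc k)). dist (fst y) (snd y) \<le> e ^ k \<and> snd y \<in> F}"
      by auto
    also have "\<dots> \<in> sets (borel \<Otimes>\<^sub>M M (Suc k))" by measurable
    finally show "{y \<in> space (borel \<Otimes>\<^sub>M M (Suc k)). snd y \<in> cball (fst y) (e ^ k) \<inter> F} \<in> sets (borel \<Otimes>\<^sub>M M (Suc k))" .
  qed simp
  have [measurable]: "(\<lambda>x. emeasure (M (Suc k)) (cball x (e ^ k))) \<in> borel_measurable borel"
    using meas[of UNIV] by simp
  show ?thesis
    unfolding \<rho>_def[abs_def] measure_def by measurable
qed

text \<open>On the paths through \<open>z = \<omega> (Suc k)\<close> the density
  \<open>g (Suc k)\<close> is constant, so conditional probabilities given \<open>z\<close> are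
  shares of the mass \<open>a (Suc k) z\<close>. Almost all these paths end in the ball, whose mass
  is at most \<open>D\<^sup>2 / c0 * a (Suc k) z\<close>; half the reciprocal of this factor is the
  threshold.\<close>

lemma half_of_\<rho>:
  assumes good: "good \<omega>" and E[measurable]: "E \<in> sets borel" and \<rho>: "\<rho> E k (\<phi> \<omega>) < c0 / (2 * D\<^sup>2)"
  shows "half E (Suc k) (\<omega> (Suc k))"
proof -
  define x z where "x = \<phi> \<omega>" and "z = \<omega> (Suc k)"
  have z: "z \<in> V (Suc k)" and zx: "dist z x \<le> 2 * e ^ Suc k"
    unfolding z_def x_def by (rule good_V[OF good], rule \<phi>_dist[OF good])
  let ?B = "cball x (e ^ k)"
  define num den where "num = measure (M (Suc k)) (?B \<inter> E)" and "den = measure (M (Suc k)) ?B"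
  have fin: "?B \<in> fmeasurable (M (Suc k))"
    using M_cball_finite[of "e ^ k" k x] by (auto simp: fmeasurable_def)
  have num_em: "emeasure (M (Suc k)) (?B \<inter> E) = ennreal num"
    unfolding num_def
  proof (rule emeasure_eq_ennreal_measure)
    have "emeasure (M (Suc k)) (?B \<inter> E) \<le> emeasure (M (Suc k)) ?B"
      by (intro emeasure_mono) auto
    then show "emeasure (M (Suc k)) (?B \<inter> E) \<noteq> top"
      using fin unfolding fmeasurable_def by (auto simp: top_unique less_top)
  qed
  have den_em: "emeasure (M (Suc k)) ?B = ennreal den"
    unfolding den_def using fin by (simp add: emeasure_eq_measure2)
  have "num \<le> den"
    unfolding num_def den_def by (rule measure_mono_fmeasurable) (use fin in auto)
  have nn: "0 \<le> num" "0 \<le> den" by (auto simp: num_def den_def)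
  have "num \<le> c0 / (2 * D\<^sup>2) * den"
  \<comment> \<open>For \<open>den = 0\<close> the quotient is 0 by convention and says nothing, but
    then \<open>num\<close> vanishes as well.\<close>
  proof (cases "den = 0")
    case False
    then show ?thesis
      using \<rho> nn unfolding \<rho>_def x_def[symmetric] num_def[symmetric] den_def[symmetric]
      by (simp add: field_simps)
  qed (use \<open>num \<le> den\<close> in simp)
  moreover have "den \<le> D\<^sup>2 / c0 * a (Suc k) z"
  proof -
    have "measure \<mu> (cball x (e ^ k)) \<le> D * measure \<mu> (cball z (e ^ Suc k / 10))"
      using zx e_le_1[of k] e_pos(1)[of k] unfolding e_Suc by (intro cball_ratio) linarith+
    also have "\<dots> \<le> D * \<nu> (Suc k) z"
      using D z by (intro mult_left_mono \<nu>_lower) auto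
    finally have 1: "measure \<mu> (cball x (e ^ k)) \<le> D * \<nu> (Suc k) z" .
    have "ennreal den \<le> ennreal (D / q) * emeasure \<mu> (cball x (e ^ k)) / ennreal ((e ^ k) powr \<theta>)"
      unfolding den_em[symmetric] by (rule M_cball_upper) auto
    also have "\<dots> = ennreal (D / q * measure \<mu> (cball x (e ^ k)) / q ^ k)"
      unfolding q_power using D q e_pos(1)[of k]
      by (subst mms_emeasure_cball(1)[OF mms]) (auto simp: divide_ennreal simp flip: ennreal_mult')
    finally have "den \<le> D / q * measure \<mu> (cball x (e ^ k)) / q ^ k"
      using D q by (subst (asm) ennreal_le_iff) auto
    also have "\<dots> \<le> D / q * (D * \<nu> (Suc k) z) / q ^ k"
      using 1 D q by (intro divide_right_mono mult_left_mono) auto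
    also have "\<dots> = D\<^sup>2 / c0 * (c0 * h (Suc k) z)"
      using c0 q by (simp add: h_def power_Suc power2_eq_square)
    also have "\<dots> \<le> D\<^sup>2 / c0 * a (Suc k) z"
      using c0 a_lower[OF z] by (intro mult_left_mono) auto
    finally show ?thesis .
  qed
  then have "c0 / (2 * D\<^sup>2) * den \<le> c0 / (2 * D\<^sup>2) * (D\<^sup>2 / c0 * a (Suc k) z)"
    using c0 by (intro mult_left_mono) auto
  moreover have "c0 / (2 * D\<^sup>2) * (D\<^sup>2 / c0 * a (Suc k) z) = a (Suc k) z / 2"
    using c0 D by (simp add: field_simps)
  ultimately have num: "2 * num \<le> a (Suc k) z" by linarith
  have P_sets: "{\<omega>. R \<omega>} \<in> sets P" if "Measurable.pred P R" for R
    using that by (simp add: pred_def)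
  have E'[measurable]: "Measurable.pred P (\<lambda>\<omega>'. \<omega>' (Suc k) = z \<and> \<phi> \<omega>' \<in> E)"
    by measurable
  let ?L = "{\<omega>'. \<omega>' (Suc k) = z \<and> \<phi> \<omega>' \<in> E}"
  have "ennreal (g (Suc k) z) * emeasure P ?L = (\<integral>\<^sup>+\<omega>'. ennreal (g (Suc k) z) * indicator ?L \<omega>' \<partial>P)"
    using P_sets[OF E'] by (simp add: nn_integral_cmult_indicator)
  also have "\<dots> \<le> (\<integral>\<^sup>+\<omega>'. ennreal (g (Suc k) (\<omega>' (Suc k))) * indicator (?B \<inter> E) (\<phi> \<omega>') \<partial>P)"
  proof (intro nn_integral_mono_AE, use AE_good in eventually_elim)
    case (elim \<omega>')
    have "\<phi> \<omega>' \<in> ?B" if "\<omega>' (Suc k) = z"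
    proof -
      have "dist x (\<phi> \<omega>') \<le> 2 * e ^ Suc k + 2 * e ^ Suc k"
        using zx \<phi>_dist[OF elim, of "Suc k"] dist_triangle3[of x "\<phi> \<omega>'" z] unfolding that by linarith
      then show ?thesis
        using e_pos(1)[of k] unfolding e_Suc mem_cball by linarith
    qed
    then show ?case by (auto split: split_indicator)
  qed
  also have "\<dots> = ennreal num"
    unfolding num_em[symmetric] by (rule emeasure_M[symmetric]) simp
  finally have L: "ennreal (g (Suc k) z) * emeasure P ?L \<le> ennreal num" .
  have "2 * (ennreal (g (Suc k) z) * emeasure P ?L) \<le> 2 * ennreal num"
    using L by (rule mult_left_mono) simp
  also have "\<dots> = ennreal (2 * num)"
    using nn by (simp add: ennreal_mult)
  also have "\<dots> \<le> ennreal (a (Suc k) z)"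
    by (rule ennreal_leI) (rule num)
  also have "\<dots> = ennreal (g (Suc k) z) * ennreal (pmf (p (Suc k)) z)"
    unfolding g_pmf[OF z, symmetric] by (rule ennreal_mult) (auto simp: g_nonneg)
  finally have le: "ennreal (g (Suc k) z) * (2 * emeasure P ?L) \<le> ennreal (g (Suc k) z) * ennreal (pmf (p (Suc k)) z)"
    by (simp add: mult_ac)
  \<comment> \<open>Positivity and finiteness allow the constant density to be cancelled, which
    leaves a statement about \<open>P\<close> alone.\<close>
  have "0 < g (Suc k) z"
    using z a_pos[OF z] pmf_p_pos[OF z] by (simp add: g_def)
  then have "2 * emeasure P ?L \<le> ennreal (pmf (p (Suc k)) z)"
    using le by (subst (asm) ennreal_mult_le_mult_iff) auto
  also have "\<dots> = emeasure P {\<omega>'. \<omega>' (Suc k) = z}"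
    using law[of "{z}" "Suc k"] by (simp add: emeasure_pmf_single del: p.simps)
  finally show ?thesis
    unfolding half_def z_def .
qed

lemma AE_upper_density:
  assumes E[measurable]: "E \<in> sets borel"
  shows "AE x in M k. x \<in> E \<longrightarrow> 0 < limsup (\<lambda>k. ereal (\<rho> E k x))"
proof -
  have [measurable]: "\<rho> E k \<in> borel_measurable borel" for k
    by (rule \<rho>_borel) fact
  \<comment> \<open>Measurability of \<open>\<rho>\<close> makes the exceptional set Borel. On it
    the densities tend below the threshold of \<open>half_of_\<rho>\<close>, so \<open>half\<close>
    holds eventually along every good path ending there.\<close>
  define A where "A = {x \<in> space borel. x \<in> E \<and> \<not> 0 < limsup (\<lambda>k. ereal (\<rho> E k x))}"
  have A[measurable]: "A \<in> sets borel"
    unfolding A_def by measurable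
  have "AE \<omega> in P. \<phi> \<omega> \<notin> A"
  proof (rule null_of_half[OF A E])
    fix \<omega> assume \<omega>: "good \<omega>" "\<phi> \<omega> \<in> A"
    have "limsup (\<lambda>k. ereal (\<rho> E k (\<phi> \<omega>))) \<le> 0"
      using \<omega> by (simp add: A_def not_less)
    also have "0 < ereal (c0 / (2 * D\<^sup>2))"
      using c0 D by simp
    finally have "eventually (\<lambda>k. ereal (\<rho> E k (\<phi> \<omega>)) < ereal (c0 / (2 * D\<^sup>2))) sequentially"
      by (rule Limsup_lessD)
    then have "eventually (\<lambda>k. half E (Suc k) (\<omega> (Suc k))) sequentially"
      by eventually_elim (rule half_of_\<rho>[OF \<omega>(1) E], simp)
    then show "eventually (\<lambda>k. half E k (\<omega> k)) sequentially"
      by (rule eventually_sequentially_Suc[THEN iffD1])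
  qed (auto simp: A_def)
  then have "AE \<omega> in P. ennreal (g k (\<omega> k)) * indicator A (\<phi> \<omega>) = 0"
    by eventually_elim simp
  then have "emeasure (M k) A = 0"
    unfolding emeasure_M[OF A] by (rule nn_integral_zero')
  then have "AE x in M k. x \<notin> A"
    by (intro AE_not_in) (simp add: null_sets_def)
  then show ?thesis
    by eventually_elim (simp add: A_def)
qed

text \<open>The shift to \<open>M (Suc k)\<close> gives room at radius \<open>e ^ k\<close>: a
  vertex of level \<open>Suc k\<close> close to the centre sends almost all its paths into the ball,
  while the upper bound persists up to that radius.\<close>

lemma strongly_regular_M: "strongly_regular_seq \<mu> \<theta> S (\<lambda>k. M (Suc k))"
  unfolding strongly_regular_seq_def regular_seq_eps_def
proof (rule exI[of _ e], intro conjI)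
  show "0 < e" "e < 1" using e by auto
  show "\<forall>k. support (M (Suc k)) = S" by (simp add: support_M)
  show "\<forall>k. is_measure_on (M (Suc k))"
    unfolding is_measure_on_def
  proof (intro conjI allI)
    fix k
    obtain x where "x \<in> support (M (Suc k))" using S_ne support_M by blast
    then have "0 < emeasure (M (Suc k)) (cball x 1)"
      by (simp add: support_def)
    also have "\<dots> \<le> emeasure (M (Suc k)) (space (M (Suc k)))"
      by (rule emeasure_space)
    finally show "emeasure (M (Suc k)) (space (M (Suc k))) \<noteq> 0" by simp
    show "\<exists>r>0. emeasure (M (Suc k)) (cball x r) < \<infinity>" for x
      using M_cball_finite[of "e ^ k" k x] by (intro exI[of _ "e ^ k"]) auto
  qed simp
  show "\<exists>C1>0. \<forall>k x r. 0 < r \<and> r \<le> e ^ k \<longrightarrow>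
      emeasure (M (Suc k)) (cball x r) \<le> ennreal C1 * emeasure \<mu> (cball x r) / ennreal (r powr \<theta>)"
  proof (intro exI[of _ "D / q"] conjI allI impI)
    show "0 < D / q" using D q by simp
  qed (elim conjE, rule M_cball_upper)
  show "\<exists>C2>0. \<forall>k. \<forall>x\<in>S. \<forall>r. e ^ k \<le> r \<and> r \<le> 1 \<longrightarrow>
      ennreal C2 * emeasure \<mu> (cball x r) / ennreal (r powr \<theta>) \<le> emeasure (M (Suc k)) (cball x r)"
  proof (intro exI[of _ "c0 / D"] conjI allI impI ballI)
    show "0 < c0 / D" using D c0 by simp
  qed (elim conjE, rule M_cball_lower)
  have eq: "e powr (\<theta> * real j) = q ^ j" for j
    using powr_powr[of e \<theta> "real j"] powr_realpow[OF q(1), of j] by (simp add: q_def)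
  show "\<exists>w :: nat \<Rightarrow> 'a \<Rightarrow> real.
        (\<forall>k. w k \<in> borel_measurable (M (Suc 0)) \<and> (\<exists>B. AE x in M (Suc 0). \<bar>w k x\<bar> \<le> B) \<and>
             (AE x in M (Suc 0). 0 \<le> w k x) \<and> M (Suc k) = density (M (Suc 0)) (\<lambda>x. ennreal (w k x))) \<and>
        (\<exists>C3>0. \<forall>k j. AE x in M (Suc 0). x \<in> S \<longrightarrow>
             e powr (\<theta> * real j) / C3 \<le> w k x / w (k + j) x \<and> w k x / w (k + j) x \<le> C3)" (is ?ex)
  proof -
    have lower: "emeasure (M (Suc k)) A \<le> emeasure (M (Suc (k + j))) A" if "A \<in> sets (M (Suc 0))" for k j A
      using that by (intro M_mono) auto
    have upper: "emeasure (M (Suc (k + j))) A \<le> ennreal (1 / q ^ j) * emeasure (M (Suc k)) A"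
      if "A \<in> sets (M (Suc 0))" for k j A
      using M_upper[of A "Suc k" j] that by simp
    show ?ex
    proof (rule regular_densities[of "\<lambda>k. M (Suc k)" q, OF sigma_finite_M _ q(1) lower upper])
      fix w :: "nat \<Rightarrow> 'a \<Rightarrow> real"
      assume w: "\<And>k. w k \<in> borel_measurable (M (Suc 0))" "\<And>k. AE x in M (Suc 0). \<bar>w k x\<bar> \<le> 1 / q ^ k"
        "\<And>k. AE x in M (Suc 0). 0 \<le> w k x" "\<And>k. M (Suc k) = density (M (Suc 0)) (\<lambda>x. ennreal (w k x))"
        "\<And>k j. AE x in M (Suc 0). q ^ j \<le> w k x / w (k + j) x \<and> w k x / w (k + j) x \<le> 1"
      \<comment> \<open>The bounds on the quotients carry no constant, so \<open>C3 = 1\<close>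
        serves for all \<open>k\<close> and \<open>j\<close>.\<close>
      have ratio: "AE x in M (Suc 0). x \<in> S \<longrightarrow> e powr (\<theta> * real j) / 1 \<le> w k x / w (k + j) x \<and> w k x / w (k + j) x \<le> 1" for k j
        using w(5)[of j k] by eventually_elim (simp add: eq)
      show ?ex
      proof (intro exI[of _ w] conjI allI)
        show "\<exists>C3>0. \<forall>k j. AE x in M (Suc 0). x \<in> S \<longrightarrow>
             e powr (\<theta> * real j) / C3 \<le> w k x / w (k + j) x \<and> w k x / w (k + j) x \<le> C3"
          using ratio by (intro exI[of _ 1] conjI allI zero_less_one)
        show "\<exists>B. AE x in M (Suc 0). \<bar>w k x\<bar> \<le> B" for k
          by (rule exI, rule w(2))
      qed (rule w)+
    qed auto
  qed
  show "\<forall>E\<in>sets borel. E \<subseteq> S \<longrightarrow> (AE x in M (Suc 0). x \<in> E \<longrightarrow>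
      0 < limsup (\<lambda>k. ereal (measure (M (Suc k)) (cball x (e ^ k) \<inter> E) / measure (M (Suc k)) (cball x (e ^ k)))))"
  proof (intro ballI impI)
    fix E :: "'a set" assume "E \<in> sets borel"
    then show "AE x in M (Suc 0). x \<in> E \<longrightarrow>
        0 < limsup (\<lambda>k. ereal (measure (M (Suc k)) (cball x (e ^ k) \<inter> E) / measure (M (Suc k)) (cball x (e ^ k))))"
      using AE_upper_density[of E "Suc 0"] by (simp only: \<rho>_def)
  qed
qed

end

section \<open>Choice of the nets and of the parents\<close>

lemma LCR_imp_strongly_regular_seq:
  fixes \<mu> :: "'a::polish_space measure"
  assumes mms: "mms \<mu>" and doubling: "unif_loc_doubling \<mu>" and \<theta>: "0 \<le> \<theta>"
    and S: "closed S" "S \<noteq> {}" and LCR: "LCR \<mu> \<theta> S"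
  shows "\<exists>m. strongly_regular_seq \<mu> \<theta> S m"
proof -
  define e :: real where "e = 1/100"
  have e: "0 < e ^ k" for k by (simp add: e_def)
  define net where "net k V \<longleftrightarrow> V \<subseteq> S \<and> countable V \<and> (\<forall>x\<in>V. \<forall>y\<in>V. x \<noteq> y \<longrightarrow> e ^ k < dist x y) \<and>
    (\<forall>x\<in>S. \<exists>y\<in>V. dist x y \<le> e ^ k)" for k V
  have "\<exists>V. net k V" for k
  proof (rule maximal_separated_net[OF e, of S k])
    fix W assume "W \<subseteq> S" "countable W" "\<And>x y. x \<in> W \<Longrightarrow> y \<in> W \<Longrightarrow> x \<noteq> y \<Longrightarrow> e ^ k < dist x y"
      "\<And>x. x \<in> S \<Longrightarrow> \<exists>y\<in>W. dist x y \<le> e ^ k"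
    then have "net k W" unfolding net_def by simp
    then show ?thesis ..
  qed
  then obtain V where "\<And>k. net k (V k)" by metis
  then have V: "\<And>k. V k \<subseteq> S" "\<And>k. countable (V k)" "\<And>k x y. x \<in> V k \<Longrightarrow> y \<in> V k \<Longrightarrow> x \<noteq> y \<Longrightarrow> e ^ k < dist x y"
    "\<And>k x. x \<in> S \<Longrightarrow> \<exists>y\<in>V k. dist x y \<le> e ^ k"
    by (simp_all add: net_def)
  \<comment> \<open>A net point within \<open>e ^ k / 2\<close>, unique by the separation, takes
    precedence, which yields the rule \<open>\<pi>_near\<close>. Otherwise any net point within
    \<open>e ^ k\<close> will do.\<close>
  define \<pi> where "\<pi> k z = (if \<exists>w\<in>V k. dist z w < e ^ k / 2 then SOME w. w \<in> V k \<and> dist z w < e ^ k / 2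
    else SOME w. w \<in> V k \<and> dist z w \<le> e ^ k)" for k z
  have \<pi>: "\<pi> k z \<in> V k \<and> dist z (\<pi> k z) \<le> e ^ k \<and> (\<forall>w\<in>V k. dist z w < e ^ k / 2 \<longrightarrow> \<pi> k z = w)"
    if z: "z \<in> S" for k z
  proof (cases "\<exists>w\<in>V k. dist z w < e ^ k / 2")
    case True
    then have \<pi>: "\<pi> k z \<in> V k \<and> dist z (\<pi> k z) < e ^ k / 2"
      unfolding \<pi>_def by (simp only: if_True) (rule someI_ex, blast)
    moreover have "\<pi> k z = w" if "w \<in> V k" "dist z w < e ^ k / 2" for w
    proof (rule ccontr)
      assume "\<pi> k z \<noteq> w"
      then have "e ^ k < dist (\<pi> k z) w" using V(3) \<pi> that by blast
      then show False
        using \<pi> that(2) dist_triangle3[of "\<pi> k z" w z] by linarith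
    qed
    moreover have "dist z (\<pi> k z) \<le> e ^ k"
      using \<pi> e[of k] by linarith
    ultimately show ?thesis by blast
  next
    case False
    then have "\<pi> k z \<in> V k \<and> dist z (\<pi> k z) \<le> e ^ k"
      unfolding \<pi>_def using V(4)[OF z, of k] by (simp only: if_False) (rule someI_ex, blast)
    with False show ?thesis by blast
  qed
  obtain D where D: "1 \<le> D" "\<And>x r. r \<in> {0<..1} \<Longrightarrow> measure \<mu> (cball x (10000000 * r)) \<le> D * measure \<mu> (cball x r)"
    using doubling_uniform[OF mms doubling, of 1 10000000] by auto
  obtain lam where lam: "0 < lam" "\<And>x r. x \<in> S \<Longrightarrow> r \<in> {0<..1} \<Longrightarrow>
      ennreal lam * emeasure \<mu> (cball x r) / ennreal (r powr \<theta>) \<le> Hcont \<mu> \<theta> r (cball x r \<inter> S)"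
    using LCR unfolding LCR_def by blast
  interpret regular_nets \<mu> \<theta> e D lam S V \<pi>
  proof
    show "\<pi> k z \<in> V k" if "z \<in> V (Suc k)" for k z
      using \<pi> V(1) that by blast
    show "dist z (\<pi> k z) \<le> e ^ k" if "z \<in> V (Suc k)" for k z
      using \<pi> V(1) that by blast
    show "\<pi> k z = w" if "z \<in> V (Suc k)" "w \<in> V k" "dist z w < e ^ k / 2" for k z w
      using \<pi> V(1) that by blast
  qed (rule mms \<theta> S V D(1) lam e_def | assumption | (rule D(2), simp))+
  show ?thesis
  proof (rule pmf_chain_measure[of \<pi> p, OF map_p])
    fix P :: "(nat \<Rightarrow> 'a) measure"
    assume "prob_space P" "sets P = sets (PiM UNIV (\<lambda>_. borel))"
      "\<And>n A. A \<in> sets borel \<Longrightarrow> emeasure P {\<omega>. \<omega> n \<in> A} = emeasure (measure_pmf (p n)) A"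
      "AE \<omega> in P. \<forall>n. \<pi> n (\<omega> (Suc n)) = \<omega> n"
    then interpret regular_nets_path \<mu> \<theta> e D lam S V \<pi> P
      by (intro regular_nets_path.intro regular_nets_path_axioms.intro regular_nets_axioms)
    show ?thesis
      by (rule exI) (rule strongly_regular_M)
  qed
qed

section \<open>Lower content regularity from a regular sequence\<close>

text \<open>Every point outside the support has a null ball around it, and by the Lindelof property
  countably many of the open balls cover the complement.\<close>

lemma emeasure_Compl_support:
  fixes m :: "'a::polish_space measure"
  assumes sets: "sets m = sets borel"
  shows "emeasure m (- support m) = 0"
proof -
  have "\<exists>r>0. emeasure m (cball x r) = 0" if "x \<in> - support m" for x
    using that by (auto simp: support_def)
  then obtain r where r: "\<And>x. x \<in> - support m \<Longrightarrow> 0 < r x \<and> emeasure m (cball x (r x)) = 0"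
    by metis
  obtain F where F: "F \<subseteq> (\<lambda>x. ball x (r x)) ` (- support m)" "countable F" "\<Union>F = (\<Union>x\<in>- support m. ball x (r x))"
    using Lindelof[of "(\<lambda>x. ball x (r x)) ` (- support m)"] by auto
  have "B \<in> null_sets m" if B: "B \<in> F" for B
  proof -
    obtain x where x: "x \<in> - support m" "B = ball x (r x)" using B F(1) by blast
    have "emeasure m B \<le> emeasure m (cball x (r x))"
      unfolding x(2) by (intro emeasure_mono) (auto simp: sets)
    then show ?thesis using r[OF x(1)] by (simp add: null_sets_def sets x(2))
  qed
  then have "(\<Union>B\<in>F. B) \<in> null_sets m"
    by (intro null_sets_UN' F(2))
  then have "emeasure m (\<Union>F) = 0" "\<Union>F \<in> sets m" by auto
  moreover have "- support m \<subseteq> \<Union>F"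
    unfolding F(3) using r by force
  ultimately show ?thesis
    by (metis emeasure_mono le_zero_eq)
qed

text \<open>The unordered sum dominates all its finite partial sums. Continuity from below along the
  initial segments of an enumeration reduces the claim to finite subadditivity.\<close>

lemma emeasure_UN_le_infsum:
  fixes f :: "'i \<Rightarrow> ennreal"
  assumes C: "countable C" and sets: "\<And>i. i \<in> C \<Longrightarrow> A i \<in> sets M"
    and le: "\<And>i. i \<in> C \<Longrightarrow> emeasure M (A i) \<le> K * f i"
  shows "emeasure M (\<Union>i\<in>C. A i) \<le> K * infsum f C"
proof (cases "C = {}")
  case False
  define F where "F n = from_nat_into C ` {..n}" for n :: nat
  have F: "finite (F n)" "F n \<subseteq> C" for n
    unfolding F_def using from_nat_into[OF False] by auto
  have "(\<Union>n. F n) = C"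
    unfolding F_def using range_from_nat_into[OF False C] by blast
  then have "(\<Union>i\<in>C. A i) = (\<Union>n. \<Union>i\<in>F n. A i)" by blast
  also have "emeasure M \<dots> = (SUP n. emeasure M (\<Union>i\<in>F n. A i))"
  proof (rule SUP_emeasure_incseq[symmetric])
    show "range (\<lambda>n. \<Union>i\<in>F n. A i) \<subseteq> sets M"
      using F sets by (auto intro!: sets.finite_UN)
    show "incseq (\<lambda>n. \<Union>i\<in>F n. A i)"
      unfolding incseq_def F_def by (intro allI impI UN_mono image_mono) auto
  qed
  also have "\<dots> \<le> K * infsum f C"
  proof (rule SUP_least)
    fix n
    have "emeasure M (\<Union>i\<in>F n. A i) \<le> (\<Sum>i\<in>F n. emeasure M (A i))"
      using F sets by (intro emeasure_subadditive_finite) auto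
    also have "\<dots> \<le> (\<Sum>i\<in>F n. K * f i)"
      using F le by (intro sum_mono) auto
    also have "\<dots> = K * (\<Sum>i\<in>F n. f i)"
      by (simp add: sum_distrib_left)
    also have "\<dots> \<le> K * infsum f C"
      using infsum_ennreal_mono_set[OF F(2), of f n] F(1) by (intro mult_left_mono) auto
    finally show "emeasure M (\<Union>i\<in>F n. A i) \<le> K * infsum f C" .
  qed
  finally show ?thesis .
qed simp

text \<open>With \<open>r\<close> between \<open>\<epsilon> ^ Suc k\<close> and
  \<open>\<epsilon> ^ k\<close>, the covering balls are in the range where \<open>m k\<close> is
  bounded above, while the lower bound at radius \<open>r\<close> is available for
  \<open>m (Suc k)\<close>. The fact \<open>step\<close> joins the two measures.\<close>

lemma regular_seq_imp_LCR:
  fixes \<mu> :: "'a::polish_space measure"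
  assumes S: "closed S" and m: "regular_seq_eps \<mu> \<theta> S \<epsilon> m"
  shows "LCR \<mu> \<theta> S"
proof -
  note conds = m[unfolded regular_seq_eps_def]
  have \<epsilon>: "0 < \<epsilon>" "\<epsilon> < 1"
    by (rule conds[THEN conjunct1], rule conds[THEN conjunct2, THEN conjunct1])
  have "\<forall>k. is_measure_on (m k)"
    using conds by (elim conjE) assumption
  then have sets: "sets (m k) = sets borel" for k
    by (simp add: is_measure_on_def)
  have "\<forall>k. support (m k) = S"
    using conds by (elim conjE) assumption
  then have supp: "support (m k) = S" for k by simp
  have "\<exists>C1>0. \<forall>k x r. 0 < r \<and> r \<le> \<epsilon> ^ k \<longrightarrow>
      emeasure (m k) (cball x r) \<le> ennreal C1 * emeasure \<mu> (cball x r) / ennreal (r powr \<theta>)"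
    using conds by (elim conjE) assumption
  then obtain C1 where C1: "0 < C1" "\<And>k x r. 0 < r \<Longrightarrow> r \<le> \<epsilon> ^ k \<Longrightarrow>
      emeasure (m k) (cball x r) \<le> ennreal C1 * emeasure \<mu> (cball x r) / ennreal (r powr \<theta>)"
    by blast
  have "\<exists>C2>0. \<forall>k. \<forall>x\<in>S. \<forall>r. \<epsilon> ^ k \<le> r \<and> r \<le> 1 \<longrightarrow>
      emeasure (m k) (cball x r) \<ge> ennreal C2 * emeasure \<mu> (cball x r) / ennreal (r powr \<theta>)"
    using conds by (elim conjE) assumption
  then obtain C2 where C2: "0 < C2" "\<And>k x r. x \<in> S \<Longrightarrow> \<epsilon> ^ k \<le> r \<Longrightarrow> r \<le> 1 \<Longrightarrow>
      ennreal C2 * emeasure \<mu> (cball x r) / ennreal (r powr \<theta>) \<le> emeasure (m k) (cball x r)"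
    by blast
  have "\<exists>w :: nat \<Rightarrow> 'a \<Rightarrow> real.
        (\<forall>k. w k \<in> borel_measurable (m 0) \<and> (\<exists>B. AE x in m 0. \<bar>w k x\<bar> \<le> B) \<and>
             (AE x in m 0. 0 \<le> w k x) \<and> m k = density (m 0) (\<lambda>x. ennreal (w k x))) \<and>
        (\<exists>C3>0. \<forall>k j. AE x in m 0. x \<in> S \<longrightarrow>
             \<epsilon> powr (\<theta> * real j) / C3 \<le> w k x / w (k + j) x \<and> w k x / w (k + j) x \<le> C3)"
    using conds by (elim conjE) assumption
  then obtain w :: "nat \<Rightarrow> 'a \<Rightarrow> real" and C3 where
    w: "\<And>k. w k \<in> borel_measurable (m 0)" "\<And>k. AE x in m 0. 0 \<le> w k x"
      "\<And>k. m k = density (m 0) (\<lambda>x. ennreal (w k x))"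
    and C3: "0 < C3" "\<And>k j. AE x in m 0. x \<in> S \<longrightarrow>
             \<epsilon> powr (\<theta> * real j) / C3 \<le> w k x / w (k + j) x \<and> w k x / w (k + j) x \<le> C3"
    by blast
  define c where "c = \<epsilon> powr \<theta> / C3"
  have c: "0 < c" using \<epsilon> C3 by (simp add: c_def)
  have AE_S: "AE x in m 0. x \<in> S"
    using emeasure_Compl_support[OF sets, of 0] S sets[of 0]
    by (intro AE_I[of _ _ "- S"]) (auto simp: supp)
  have step: "ennreal c * emeasure (m (Suc k)) A \<le> emeasure (m k) A" if A: "A \<in> sets borel" for k A
  proof -
    have A0: "A \<in> sets (m 0)" using A sets by simp
    have "AE x in m 0. ennreal c * ennreal (w (Suc k) x) \<le> ennreal (w k x)"
      using AE_S C3(2)[where k=k and j=1] w(2)[of k] w(2)[of "Suc k"]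
    proof eventually_elim
      case (elim x)
      then have r: "c \<le> w k x / w (Suc k) x" "0 \<le> w (Suc k) x" by (auto simp: c_def)
      \<comment> \<open>A zero denominator would make the quotient 0 by convention, against its
        positive lower bound \<open>c\<close>.\<close>
      with c have "w (Suc k) x \<noteq> 0" by auto
      with r have "c * w (Suc k) x \<le> w k x" by (simp add: field_simps)
      then show ?case using c r by (subst ennreal_mult[symmetric]) (auto intro: ennreal_leI)
    qed
    then have "(\<integral>\<^sup>+x. ennreal c * (ennreal (w (Suc k) x) * indicator A x) \<partial>m 0) \<le> (\<integral>\<^sup>+x. ennreal (w k x) * indicator A x \<partial>m 0)"
      by (intro nn_integral_mono_AE, eventually_elim) (auto split: split_indicator)
    also have "\<dots> = emeasure (m k) A"
      unfolding w(3)[of k] using A0 w(1) by (intro emeasure_density[symmetric]) auto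
    also have "(\<integral>\<^sup>+x. ennreal c * (ennreal (w (Suc k) x) * indicator A x) \<partial>m 0) = ennreal c * emeasure (m (Suc k)) A"
      unfolding w(3)[of "Suc k"] using A0 w(1)
      by (subst emeasure_density) (auto intro!: nn_integral_cmult borel_measurable_times_ennreal measurable_compose[OF w(1)])
    finally show ?thesis .
  qed
  define lam where "lam = c * C2 / C1"
  have lam: "0 < lam" using c C1 C2 by (simp add: lam_def)
  have "ennreal lam * emeasure \<mu> (cball x r) / ennreal (r powr \<theta>) \<le> Hcont \<mu> \<theta> r (cball x r \<inter> S)"
    if x: "x \<in> S" and r: "r \<in> {0<..1}" for x r
    unfolding Hcont_def
  proof (rule INF_greatest, safe)
    fix C :: "('a \<times> real) set"
    assume C: "countable C" "\<forall>(x, r')\<in>C. 0 < r' \<and> r' < r" "cball x r \<inter> S \<subseteq> (\<Union>(x, r)\<in>C. cball x r)"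
    obtain k where k: "\<epsilon> ^ Suc k \<le> r" "r \<le> \<epsilon> ^ k"
    proof -
      define n where "n = (LEAST n. \<epsilon> ^ Suc n \<le> r)"
      have "\<exists>n. \<epsilon> ^ n < r" using r \<epsilon> by (intro real_arch_pow_inv) auto
      then obtain n' where "\<epsilon> ^ n' < r" by blast
      moreover have "\<epsilon> ^ Suc n' \<le> \<epsilon> ^ n'" using \<epsilon> by (intro power_decreasing) auto
      ultimately have "\<epsilon> ^ Suc n' \<le> r" by linarith
      then have 1: "\<epsilon> ^ Suc n \<le> r" unfolding n_def by (rule LeastI)
      moreover have "r \<le> \<epsilon> ^ n"
      proof (cases n)
        case (Suc i)
        then show ?thesis
          using not_less_Least[of i "\<lambda>n. \<epsilon> ^ Suc n \<le> r"] unfolding n_def[symmetric] by simp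
      qed (use r in simp)
      ultimately show ?thesis by (rule that)
    qed
    \<comment> \<open>The content concerns coverings of \<open>cball x r \<inter> S\<close> only; as
      \<open>m k\<close> is carried by its support \<open>S\<close>, they still catch the full mass
      of the ball.\<close>
    have S_cball: "emeasure (m k) (cball x r) = emeasure (m k) (cball x r \<inter> S)"
    proof -
      have "AE y in m k. y \<in> S"
        using emeasure_Compl_support[OF sets, of k] S sets[of k]
        by (intro AE_I[of _ _ "- S"]) (auto simp: supp)
      then show ?thesis
        using S by (intro emeasure_eq_AE) (auto simp: sets)
    qed
    have "ennreal c * (ennreal C2 * emeasure \<mu> (cball x r) / ennreal (r powr \<theta>)) \<le> ennreal c * emeasure (m (Suc k)) (cball x r)"
      using x r k by (intro mult_left_mono C2) auto
    also have "\<dots> \<le> emeasure (m k) (cball x r)" by (rule step) simp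
    also have "\<dots> \<le> emeasure (m k) (\<Union>(y,s)\<in>C. cball y s)"
      unfolding S_cball using C by (intro emeasure_mono) (auto simp: sets intro!: sets.countable_UN'')
    also have "\<dots> \<le> ennreal C1 * (\<Sum>\<^sub>\<infinity>(y,s)\<in>C. emeasure \<mu> (cball y s) / ennreal (s powr \<theta>))"
    proof (rule emeasure_UN_le_infsum[OF C(1)])
      fix ys assume "ys \<in> C"
      then obtain y s where ys: "ys = (y, s)" "0 < s" "s < r" using C(2) by auto
      show "(case ys of (y, s) \<Rightarrow> cball y s) \<in> sets (m k)"
        by (simp add: sets ys)
      show "emeasure (m k) (case ys of (y, s) \<Rightarrow> cball y s)
          \<le> ennreal C1 * (case ys of (y, s) \<Rightarrow> emeasure \<mu> (cball y s) / ennreal (s powr \<theta>))"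
        using C1(2)[of s k y] ys k by (simp add: ennreal_times_divide)
    qed
    finally have "ennreal c * (ennreal C2 * emeasure \<mu> (cball x r) / ennreal (r powr \<theta>))
        \<le> ennreal C1 * (\<Sum>\<^sub>\<infinity>(y,s)\<in>C. emeasure \<mu> (cball y s) / ennreal (s powr \<theta>))" .
    then have "ennreal (1 / C1) * (ennreal c * (ennreal C2 * emeasure \<mu> (cball x r) / ennreal (r powr \<theta>)))
        \<le> ennreal (1 / C1) * (ennreal C1 * (\<Sum>\<^sub>\<infinity>(y,s)\<in>C. emeasure \<mu> (cball y s) / ennreal (s powr \<theta>)))"
      by (rule mult_left_mono) simp
    also have "\<dots> = (\<Sum>\<^sub>\<infinity>(y,s)\<in>C. emeasure \<mu> (cball y s) / ennreal (s powr \<theta>))"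
      using C1(1) by (simp add: mult.assoc[symmetric] flip: ennreal_mult)
    also have "ennreal (1 / C1) * (ennreal c * (ennreal C2 * emeasure \<mu> (cball x r) / ennreal (r powr \<theta>)))
        = ennreal lam * emeasure \<mu> (cball x r) / ennreal (r powr \<theta>)"
    proof -
      have "ennreal (1 / C1) * (ennreal c * ennreal C2) = ennreal lam"
        unfolding lam_def using c C1 C2 by (simp add: field_simps flip: ennreal_mult)
      then show ?thesis
        by (simp add: ennreal_times_divide mult.assoc[symmetric])
    qed
    finally show "ennreal lam * emeasure \<mu> (cball x r) / ennreal (r powr \<theta>)
        \<le> (\<Sum>\<^sub>\<infinity>(y,s)\<in>C. emeasure \<mu> (cball y s) / ennreal (s powr \<theta>))" .
  qed
  then show ?thesis
    unfolding LCR_def using lam by blast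
qed

theorem theorem1:
  fixes \<mu> :: "'a::polish_space measure" and p \<theta> :: real and S :: "'a set"
  assumes "1 < p" and "admissible \<mu> p" and "0 \<le> \<theta>" and "closed S" and "S \<noteq> {}"
  shows "(LCR \<mu> \<theta> S \<longrightarrow> (\<exists>m. strongly_regular_seq \<mu> \<theta> S m)) \<and>
         ((\<exists>m. regular_seq \<mu> \<theta> S m) \<longrightarrow> LCR \<mu> \<theta> S)"
proof -
  have \<mu>: "mms \<mu>" "unif_loc_doubling \<mu>"
    using assms(2) by (simp_all add: admissible_def)
  show ?thesis
  proof (intro conjI impI)
    assume "LCR \<mu> \<theta> S"
    then show "\<exists>m. strongly_regular_seq \<mu> \<theta> S m"
      by (rule LCR_imp_strongly_regular_seq[OF \<mu> assms(3-5)])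
  next
    assume "\<exists>m. regular_seq \<mu> \<theta> S m"
    then obtain m \<epsilon> where "regular_seq_eps \<mu> \<theta> S \<epsilon> m"
      by (auto simp: regular_seq_def)
    then show "LCR \<mu> \<theta> S"
      by (rule regular_seq_imp_LCR[OF assms(4)])
  qed
qed

end
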